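(* Let $\Sigma$ be an oriented surface and $\nabla$ a timelike/spacelike Lagrangian connection on $T\Sigma$ that is totally geodesic. Then $\nabla$ is the Levi-Civita connection of a Riemannian metric $g$ of Gauss curvature $K_g=\pm1$ (with $+1$ in the timelike case and $-1$ in the spacelike case).
   Context: All manifolds and maps are smooth; surfaces have no boundary. For a torsion-free connection $\nabla$ on $T\Sigma$ the Ricci tensor is $\mathrm{Ric}(\nabla)(X,Y)=\mathrm{tr}\,(Z\mapsto \nabla_Z\nabla_XY-\nabla_X\nabla_ZY-\nabla_{[Z,X]}Y)$, with symmetric part $\mathrm{Ric}^+(\nabla)$ and anti-symmetric part $\mathrm{Ric}^-(\nabla)$; put $\mathrm{Schout}(\nabla)=\mathrm{Ric}^+(\nabla)-\frac13\mathrm{Ric}^-(\nabla)$. Define a split-signature metric $h_\nabla$ on the total space of $T^*\Sigma$ as follows: in local coordinates $x^i$ on $\Sigma$ with fibre coordinates $\xi_i$ (covector $\xi_i dx^i$), with $\nabla_{\partial_i}\partial_j=\Gamma^k_{ij}\partial_k$ and $\mathrm{Schout}(\nabla)=S_{ij}dx^i\otimes dx^j$, let $\psi_i=d\xi_i-\xi_k\Gamma^k_{ij}dx^j-\xi_i\xi_jdx^j-S_{ji}dx^j$; then $h_\nabla$ is the symmetric part of $\psi_i\otimes dx^i$ (coordinate independent). With $o:\Sigma\to T^*\Sigma$ the zero section, $o^*h_\nabla=-\mathrm{Ric}^+(\nabla)$. A torsion-free connection $\nabla$ is called Lagrangian if $\mathrm{Ric}^-(\nabla)=0$, timelike (spacelike)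 if $\mathrm{Ric}^+(\nabla)$ is positive (negative) definite. A timelike/spacelike connection is called totally geodesic if $o:\Sigma\to(T^*\Sigma,h_\nabla)$ is a totally geodesic submanifold, i.e. its second fundamental form vanishes identically. *)

theory Defs
  imports "HOL-Analysis.Analysis" "HOL-Library.Function_Algebras"
begin

section \<open>Smooth maps between vector spaces\<close>

text \<open>Meant for open sets \<open>U\<close>; the \<open>k\<close>-th order condition is on iterated directional derivatives.\<close>

primrec Ck_on :: "nat \<Rightarrow> 'e::euclidean_space set \<Rightarrow> ('e \<Rightarrow> 'b::real_normed_vector) \<Rightarrow> bool" where
  "Ck_on 0 U f \<longleftrightarrow> continuous_on U f"
| "Ck_on (Suc k) U f \<longleftrightarrow> (\<forall>x\<in>U. f differentiable (at x)) \<and>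
     (\<forall>v. Ck_on k U (\<lambda>x. frechet_derivative f (at x) v))"

definition smooth_on :: "'e::euclidean_space set \<Rightarrow> ('e \<Rightarrow> 'b::real_normed_vector) \<Rightarrow> bool" where
  "smooth_on U f \<longleftrightarrow> (\<forall>k. Ck_on k U f)"


section \<open>Surfaces\<close>

text \<open>
  The points of the surface are all elements of a second countable Hausdorff type \<open>'a\<close>; the smooth
  structure is given by an atlas \<open>A\<close>, not required to be maximal. A chart consists of its domain
  and its coordinate map; the values of the latter outside the domain are irrelevant.
\<close>

type_synonym 'a chart = "'a set \<times> ('a \<Rightarrow> real^2)"

abbreviation chart_dom :: "'a chart \<Rightarrow> 'a set" where "chart_dom \<equiv> fst"
abbreviation chart_map :: "'a chart \<Rightarrow> 'a \<Rightarrow> real^2" where "chart_map \<equiv> snd"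

definition chart_inv :: "'a chart \<Rightarrow> real^2 \<Rightarrow> 'a" where
  "chart_inv c = inv_into (chart_dom c) (chart_map c)"

definition is_chart :: "'a::topological_space chart \<Rightarrow> bool" where
  "is_chart c \<longleftrightarrow> open (chart_dom c) \<and> open (chart_map c ` chart_dom c) \<and>
     homeomorphism (chart_dom c) (chart_map c ` chart_dom c) (chart_map c) (chart_inv c)"

definition transition :: "'a chart \<Rightarrow> 'a chart \<Rightarrow> real^2 \<Rightarrow> real^2" where
  "transition c d = chart_map d \<circ> chart_inv c"

definition surface :: "'a::{t2_space, second_countable_topology} chart set \<Rightarrow> bool" where
  "surface A \<longleftrightarrow> (\<forall>c\<in>A. is_chart c) \<and> (\<Union>c\<in>A. chart_dom c) = UNIV \<and>
     (\<forall>c\<in>A. \<forall>d\<in>A. smooth_on (chart_map c ` (chart_dom c \<inter> chart_dom d)) (transition c d))"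

definition oriented_surface :: "'a::{t2_space, second_countable_topology} chart set \<Rightarrow> bool" where
  "oriented_surface A \<longleftrightarrow> surface A \<and>
     (\<forall>c\<in>A. \<forall>d\<in>A. \<forall>p\<in>chart_dom c \<inter> chart_dom d.
        det (matrix (frechet_derivative (transition c d) (at (chart_map c p)))) > 0)"

text \<open>Some chart around \<open>p\<close>; used only for quantities that do not depend on the chart.\<close>

definition chart_at :: "'a chart set \<Rightarrow> 'a \<Rightarrow> 'a chart" where
  "chart_at A p = (SOME c. c \<in> A \<and> p \<in> chart_dom c)"

definition smooth_fun :: "'a chart set \<Rightarrow> 'a set \<Rightarrow> ('a \<Rightarrow> real) \<Rightarrow> bool" where
  "smooth_fun A W f \<longleftrightarrow> (\<forall>c\<in>A. smooth_on (chart_map c ` (chart_dom c \<inter> W)) (f \<circ> chart_inv c))"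

definition smooth_at :: "'a::topological_space chart set \<Rightarrow> 'a \<Rightarrow> ('a \<Rightarrow> real) \<Rightarrow> bool" where
  "smooth_at A p f \<longleftrightarrow> (\<exists>W. open W \<and> p \<in> W \<and> smooth_fun A W f)"


section \<open>Tangent vectors and vector fields\<close>

text \<open>
  A tangent vector at \<open>p\<close> is a directional derivative operator on the functions that are smooth
  near \<open>p\<close>, extended by zero to all other functions so that equality of tangent vectors is
  equality of operators.
\<close>

type_synonym 'a tvec = "('a \<Rightarrow> real) \<Rightarrow> real"

type_synonym 'a vfield = "'a \<Rightarrow> 'a tvec"

definition coord_vec :: "'a::topological_space chart set \<Rightarrow> 'a chart \<Rightarrow> 'a \<Rightarrow> real^2 \<Rightarrow> 'a tvec" where
  "coord_vec A c p w = (\<lambda>f. if smooth_at A p f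
     then frechet_derivative (f \<circ> chart_inv c) (at (chart_map c p)) w else 0)"

definition tangent_space :: "'a::topological_space chart set \<Rightarrow> 'a \<Rightarrow> 'a tvec set" where
  "tangent_space A p = {coord_vec A c p w | c w. c \<in> A \<and> p \<in> chart_dom c}"

definition components :: "'a chart \<Rightarrow> 'a tvec \<Rightarrow> real^2" where
  "components c v = (\<chi> i. v (\<lambda>q. chart_map c q $ i))"

text \<open>The coordinate vector field \<open>\<partial>\<^sub>i\<close> of the chart \<open>c\<close>, meaningful on the domain of \<open>c\<close>.\<close>

definition coord_field :: "'a::topological_space chart set \<Rightarrow> 'a chart \<Rightarrow> 2 \<Rightarrow> 'a vfield" where
  "coord_field A c i = (\<lambda>p. coord_vec A c p (axis i 1))"

text \<open>Vector fields are total functions; only their values on the set \<open>W\<close> are constrained.\<close>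

definition smooth_field :: "'a::topological_space chart set \<Rightarrow> 'a set \<Rightarrow> 'a vfield \<Rightarrow> bool" where
  "smooth_field A W X \<longleftrightarrow> (\<forall>p\<in>W. X p \<in> tangent_space A p) \<and>
     (\<forall>c\<in>A. smooth_on (chart_map c ` (chart_dom c \<inter> W))
        (\<lambda>x. components c (X (chart_inv c x))))"

definition vscale :: "real \<Rightarrow> 'a tvec \<Rightarrow> 'a tvec" where
  "vscale r v = (\<lambda>f. r * v f)"

definition field_scale :: "('a \<Rightarrow> real) \<Rightarrow> 'a vfield \<Rightarrow> 'a vfield" where
  "field_scale f X = (\<lambda>p. vscale (f p) (X p))"

definition lie_bracket :: "'a::topological_space chart set \<Rightarrow> 'a vfield \<Rightarrow> 'a vfield \<Rightarrow> 'a vfield" where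
  "lie_bracket A X Y = (\<lambda>p f. if smooth_at A p f
     then X p (\<lambda>q. Y q f) - Y p (\<lambda>q. X q f) else 0)"


section \<open>Connections and their Ricci tensor\<close>

text \<open>
  A connection on the tangent bundle, as a covariant derivative \<open>D X Y\<close> acting on vector fields
  that are defined on arbitrary open sets \<open>W\<close>. Here \<open>D X Y\<close> is only constrained at points near
  which both fields are smooth. Compatibility with restriction to smaller open sets is built in,
  because the same total function \<open>D X Y\<close> serves every \<open>W\<close>.
\<close>

type_synonym 'a covd = "'a vfield \<Rightarrow> 'a vfield \<Rightarrow> 'a vfield"

definition is_connection :: "'a::topological_space chart set \<Rightarrow> 'a covd \<Rightarrow> bool" where
  "is_connection A D \<longleftrightarrow> (\<forall>W. open W \<longrightarrow>
     (\<forall>X Y. smooth_field A W X \<longrightarrow> smooth_field A W Y \<longrightarrow> smooth_field A W (D X Y)) \<and>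
     (\<forall>X X' Y. smooth_field A W X \<longrightarrow> smooth_field A W X' \<longrightarrow> smooth_field A W Y \<longrightarrow>
        (\<forall>p\<in>W. D (X + X') Y p = D X Y p + D X' Y p)) \<and>
     (\<forall>f X Y. smooth_fun A W f \<longrightarrow> smooth_field A W X \<longrightarrow> smooth_field A W Y \<longrightarrow>
        (\<forall>p\<in>W. D (field_scale f X) Y p = vscale (f p) (D X Y p))) \<and>
     (\<forall>X Y Y'. smooth_field A W X \<longrightarrow> smooth_field A W Y \<longrightarrow> smooth_field A W Y' \<longrightarrow>
        (\<forall>p\<in>W. D X (Y + Y') p = D X Y p + D X Y' p)) \<and>
     (\<forall>f X Y. smooth_fun A W f \<longrightarrow> smooth_field A W X \<longrightarrow> smooth_field A W Y \<longrightarrow>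
        (\<forall>p\<in>W. D X (field_scale f Y) p = vscale (X p f) (Y p) + vscale (f p) (D X Y p))))"

definition torsion_free :: "'a::topological_space chart set \<Rightarrow> 'a covd \<Rightarrow> bool" where
  "torsion_free A D \<longleftrightarrow> (\<forall>W X Y. open W \<longrightarrow> smooth_field A W X \<longrightarrow> smooth_field A W Y \<longrightarrow>
     (\<forall>p\<in>W. D X Y p - D Y X p = lie_bracket A X Y p))"

definition curvature ::
    "'a::topological_space chart set \<Rightarrow> 'a covd \<Rightarrow> 'a vfield \<Rightarrow> 'a vfield \<Rightarrow> 'a vfield \<Rightarrow> 'a vfield" where
  "curvature A D X Y Z = D X (D Y Z) - D Y (D X Z) - D (lie_bracket A X Y) Z"

text \<open>The trace of \<open>Z \<mapsto> R(Z,X)Y\<close>, computed in the coordinate frame of a chart around \<open>p\<close>.\<close>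

definition ricci ::
    "'a::topological_space chart set \<Rightarrow> 'a covd \<Rightarrow> 'a vfield \<Rightarrow> 'a vfield \<Rightarrow> 'a \<Rightarrow> real" where
  "ricci A D X Y p = (let c = chart_at A p in
     \<Sum>k\<in>UNIV. components c (curvature A D (coord_field A c k) X Y p) $ k)"

definition ricci_sym ::
    "'a::topological_space chart set \<Rightarrow> 'a covd \<Rightarrow> 'a vfield \<Rightarrow> 'a vfield \<Rightarrow> 'a \<Rightarrow> real" where
  "ricci_sym A D X Y p = (ricci A D X Y p + ricci A D Y X p) / 2"

definition ricci_skew ::
    "'a::topological_space chart set \<Rightarrow> 'a covd \<Rightarrow> 'a vfield \<Rightarrow> 'a vfield \<Rightarrow> 'a \<Rightarrow> real" where
  "ricci_skew A D X Y p = (ricci A D X Y p - ricci A D Y X p) / 2"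

definition schouten ::
    "'a::topological_space chart set \<Rightarrow> 'a covd \<Rightarrow> 'a vfield \<Rightarrow> 'a vfield \<Rightarrow> 'a \<Rightarrow> real" where
  "schouten A D X Y p = ricci_sym A D X Y p - ricci_skew A D X Y p / 3"

definition lagrangian :: "'a::topological_space chart set \<Rightarrow> 'a covd \<Rightarrow> bool" where
  "lagrangian A D \<longleftrightarrow> (\<forall>W X Y. open W \<longrightarrow> smooth_field A W X \<longrightarrow> smooth_field A W Y \<longrightarrow>
     (\<forall>p\<in>W. ricci_skew A D X Y p = 0))"

definition timelike :: "'a::topological_space chart set \<Rightarrow> 'a covd \<Rightarrow> bool" where
  "timelike A D \<longleftrightarrow> (\<forall>W X. open W \<longrightarrow> smooth_field A W X \<longrightarrow>
     (\<forall>p\<in>W. X p \<noteq> 0 \<longrightarrow> ricci_sym A D X X p > 0))"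

definition spacelike :: "'a::topological_space chart set \<Rightarrow> 'a covd \<Rightarrow> bool" where
  "spacelike A D \<longleftrightarrow> (\<forall>W X. open W \<longrightarrow> smooth_field A W X \<longrightarrow>
     (\<forall>p\<in>W. X p \<noteq> 0 \<longrightarrow> ricci_sym A D X X p < 0))"


section \<open>Second fundamental form in coordinates\<close>

text \<open>
  A pseudo-Riemannian metric on an open subset of a Euclidean space \<open>'e\<close> is a function \<open>h\<close> with
  values in the symmetric nondegenerate bilinear forms. \<open>lc_christoffel h z\<close> is its Levi-Civita
  connection at \<open>z\<close> on constant fields: the unique torsion-free (that is, symmetric) and metric one.
\<close>

definition lc_christoffel :: "('e::euclidean_space \<Rightarrow> 'e \<Rightarrow> 'e \<Rightarrow> real) \<Rightarrow> 'e \<Rightarrow> 'e \<Rightarrow> 'e \<Rightarrow> 'e" where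
  "lc_christoffel h z = (THE G. bilinear G \<and> (\<forall>u v. G u v = G v u) \<and>
     (\<forall>t u v. frechet_derivative (\<lambda>y. h y u v) (at z) t = h z (G t u) v + h z u (G t v)))"

text \<open>Component of \<open>w\<close> orthogonal to a subspace \<open>T\<close> on which the form \<open>b\<close> is nondegenerate.\<close>

definition normal_component :: "('e::euclidean_space \<Rightarrow> 'e \<Rightarrow> real) \<Rightarrow> 'e set \<Rightarrow> 'e \<Rightarrow> 'e" where
  "normal_component b T w = w - (THE t. t \<in> T \<and> (\<forall>u\<in>T. b (w - t) u = 0))"

text \<open>For an immersion \<open>F\<close>: the normal component of the derivative of \<open>dF v\<close> along \<open>dF u\<close>.\<close>

definition second_fundamental_form ::
    "('e::euclidean_space \<Rightarrow> 'e \<Rightarrow> 'e \<Rightarrow> real) \<Rightarrow> ('d::euclidean_space \<Rightarrow> 'e) \<Rightarrow> 'd \<Rightarrow> 'd \<Rightarrow> 'd \<Rightarrow> 'e" where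
  "second_fundamental_form h F x u v =
     (let dF = \<lambda>y. frechet_derivative F (at y) in
      normal_component (h (F x)) (range (dF x))
        (frechet_derivative (\<lambda>y. dF y v) (at x) u + lc_christoffel h (F x) (dF x u) (dF x v)))"


section \<open>The metric on the cotangent bundle and totally geodesic connections\<close>

text \<open>\<open>christoffel A D c k i j x\<close> is \<open>\<Gamma>\<^sup>k\<^sub>i\<^sub>j\<close> at the point with coordinates \<open>x\<close>.\<close>

definition christoffel ::
    "'a::topological_space chart set \<Rightarrow> 'a covd \<Rightarrow> 'a chart \<Rightarrow> 2 \<Rightarrow> 2 \<Rightarrow> 2 \<Rightarrow> real^2 \<Rightarrow> real" where
  "christoffel A D c k i j x =
     components c (D (coord_field A c i) (coord_field A c j) (chart_inv c x)) $ k"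

definition schouten_coord ::
    "'a::topological_space chart set \<Rightarrow> 'a covd \<Rightarrow> 'a chart \<Rightarrow> 2 \<Rightarrow> 2 \<Rightarrow> real^2 \<Rightarrow> real" where
  "schouten_coord A D c i j x = schouten A D (coord_field A c i) (coord_field A c j) (chart_inv c x)"

text \<open>
  A chart \<open>c\<close> of the surface with image \<open>V\<close> induces the chart \<open>(x, \<xi>)\<close> of the cotangent bundle
  with image \<open>V \<times> \<real>\<^sup>2\<close>, in which \<open>(x, \<xi>)\<close> represents the covector \<open>\<xi>\<^sub>i dx\<^sup>i\<close> at \<open>x\<close>. Tangent
  vectors \<open>(a, \<alpha>)\<close> to the cotangent bundle have \<open>dx\<^sup>i(a, \<alpha>) = a\<^sup>i\<close> and \<open>d\<xi>\<^sub>i(a, \<alpha>) = \<alpha>\<^sub>i\<close>.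
\<close>

definition psi_form ::
    "'a::topological_space chart set \<Rightarrow> 'a covd \<Rightarrow> 'a chart \<Rightarrow> 2 \<Rightarrow> (real^2) \<times> (real^2)
      \<Rightarrow> (real^2) \<times> (real^2) \<Rightarrow> real" where
  "psi_form A D c i = (\<lambda>(x, \<xi>) (a, \<alpha>).
     \<alpha> $ i
     - (\<Sum>k\<in>UNIV. \<Sum>j\<in>UNIV. \<xi> $ k * christoffel A D c k i j x * a $ j)
     - (\<Sum>j\<in>UNIV. \<xi> $ i * \<xi> $ j * a $ j)
     - (\<Sum>j\<in>UNIV. schouten_coord A D c j i x * a $ j))"

text \<open>The coordinate expression of \<open>h\<close>, the symmetric part of \<open>\<psi>\<^sub>i \<otimes> dx\<^sup>i\<close>.\<close>

definition cotangent_metric ::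
    "'a::topological_space chart set \<Rightarrow> 'a covd \<Rightarrow> 'a chart \<Rightarrow> (real^2) \<times> (real^2)
      \<Rightarrow> (real^2) \<times> (real^2) \<Rightarrow> (real^2) \<times> (real^2) \<Rightarrow> real" where
  "cotangent_metric A D c z s t =
     (\<Sum>i\<in>UNIV. psi_form A D c i z s * fst t $ i + psi_form A D c i z t * fst s $ i) / 2"

definition zero_section :: "real^2 \<Rightarrow> (real^2) \<times> (real^2)" where
  "zero_section x = (x, 0)"

text \<open>
  Total geodesy of the zero section, tested in all the charts of the cotangent bundle induced by
  \<open>A\<close>. Used for timelike and spacelike connections, where the zero section is nondegenerate.
\<close>

definition totally_geodesic :: "'a::topological_space chart set \<Rightarrow> 'a covd \<Rightarrow> bool" where
  "totally_geodesic A D \<longleftrightarrow> (\<forall>c\<in>A. \<forall>p\<in>chart_dom c. \<forall>u v.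
     second_fundamental_form (cotangent_metric A D c) zero_section (chart_map c p) u v = 0)"


section \<open>Riemannian metrics, Levi-Civita connection, Gauss curvature\<close>

type_synonym 'a metric = "'a \<Rightarrow> 'a tvec \<Rightarrow> 'a tvec \<Rightarrow> real"

definition riemannian_metric :: "'a::topological_space chart set \<Rightarrow> 'a metric \<Rightarrow> bool" where
  "riemannian_metric A g \<longleftrightarrow>
     (\<forall>p. \<forall>u\<in>tangent_space A p. \<forall>v\<in>tangent_space A p. \<forall>w\<in>tangent_space A p. \<forall>r.
        g p u v = g p v u \<and> g p (u + w) v = g p u v + g p w v \<and> g p (vscale r u) v = r * g p u v) \<and>
     (\<forall>p. \<forall>v\<in>tangent_space A p. v \<noteq> 0 \<longrightarrow> g p v v > 0) \<and>
     (\<forall>W X Y. open W \<longrightarrow> smooth_field A W X \<longrightarrow> smooth_field A W Y \<longrightarrow>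
        smooth_fun A W (\<lambda>p. g p (X p) (Y p)))"

definition levi_civita :: "'a::topological_space chart set \<Rightarrow> 'a metric \<Rightarrow> 'a covd \<Rightarrow> bool" where
  "levi_civita A g D \<longleftrightarrow> is_connection A D \<and> torsion_free A D \<and>
     (\<forall>W X Y Z. open W \<longrightarrow> smooth_field A W X \<longrightarrow> smooth_field A W Y \<longrightarrow> smooth_field A W Z \<longrightarrow>
        (\<forall>p\<in>W. X p (\<lambda>q. g q (Y q) (Z q)) = g p (D X Y p) (Z p) + g p (Y p) (D X Z p)))"

text \<open>
  The sectional curvature of the tangent plane at \<open>p\<close>. The Levi-Civita connection of \<open>g\<close> is unique
  up to the irrelevant values of \<open>D X Y\<close> at points where \<open>X\<close> or \<open>Y\<close> is not smooth.
\<close>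

definition gauss_curvature :: "'a::topological_space chart set \<Rightarrow> 'a metric \<Rightarrow> 'a \<Rightarrow> real" where
  "gauss_curvature A g p =
     (let D = (SOME D. levi_civita A g D);
          E1 = coord_field A (chart_at A p) 1;
          E2 = coord_field A (chart_at A p) 2
      in g p (curvature A D E1 E2 E2 p) (E1 p) /
         (g p (E1 p) (E1 p) * g p (E2 p) (E2 p) - (g p (E1 p) (E2 p))\<^sup>2))"

end

theory Submission
  imports Defs
begin

text \<open>
  Along the zero section, the Koszul formula for \<open>h\<close> in the coordinates \<open>(x, \<xi>)\<close> shows that
  \<open>\<nabla>\<^sup>h(u, v)\<close> is tangent to the zero section only if its base component is \<open>\<Gamma>(u, v)\<close> and
  \<open>S(\<Gamma>(u, v), w) = (\<partial>\<^sub>u S(v, w) + \<partial>\<^sub>v S(u, w) - \<partial>\<^sub>w S(u, v)) / 2\<close>. Hence a totally geodesic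
  Lagrangian connection has parallel Ricci tensor, and being torsion-free it is the Levi-Civita
  connection of \<open>g = \<plusminus>Ric\<close>. In dimension two the trace defining \<open>Ric\<close> gives
  \<open>R(E\<^sub>1, E\<^sub>2)E\<^sub>2 = Ric\<^sub>2\<^sub>2 E\<^sub>1 - Ric\<^sub>1\<^sub>2 E\<^sub>2\<close>, so that \<open>g(R(E\<^sub>1, E\<^sub>2)E\<^sub>2, E\<^sub>1)\<close> is \<open>\<plusminus>1\<close> times the
  Gram determinant of \<open>g\<close>.
\<close>

section \<open>Calculus of smooth maps\<close>

text \<open>Vertical test vectors pin the base component to \<open>\<Gamma>(u, v)\<close> because
  the fibre derivative of \<open>h\<close> at the zero section is minus the Christoffel map; the
  term quadratic in the covector vanishes there to second order. Parallelism comes from adding the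
  identity for \<open>S\<close> to the same identity with \<open>v\<close> and \<open>w\<close>
  exchanged: the two derivatives not taken along \<open>u\<close> cancel. The encoding shapes the
  rest. Vector fields are total functions and a connection is constrained only where its arguments
  are smooth, so curvature and Ricci act on fields, and locality has to be derived. Before Ric can
  be a metric, it must be shown to depend only on the values of its arguments at a point, and not on
  the chart in which the trace is taken; the notion \<open>tensorial\<close> carries this. The Gauss
  curvature uses a Levi-Civita connection selected by choice, hence the uniqueness proof. A real
  \<epsilon> with \<epsilon> Ric positive definite treats both causal types at once. The curvature
  comes out as 1/\<epsilon>, since its numerator is linear in \<epsilon> and the Gram determinant
  quadratic.\<close>

lemma frechet_derivative_cong_open:
  assumes "open U" "x \<in> U" "\<And>y. y \<in> U \<Longrightarrow> f y = g y"
  shows "frechet_derivative f (at x) = frechet_derivative g (at x)"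
    and "f differentiable (at x) \<longleftrightarrow> g differentiable (at x)"
proof -
  have *: "(f has_derivative F) (at x) \<longleftrightarrow> (g has_derivative F) (at x)" for F
    using has_derivative_transform_within_open[of f F x UNIV U g]
      has_derivative_transform_within_open[of g F x UNIV U f] assms by auto
  show "frechet_derivative f (at x) = frechet_derivative g (at x)"
    unfolding frechet_derivative_def by (simp add: *)
  show "f differentiable (at x) \<longleftrightarrow> g differentiable (at x)"
    unfolding differentiable_def by (simp add: *)
qed

lemma has_derivative_frechet:
  "f differentiable (at x) \<Longrightarrow> (f has_derivative frechet_derivative f (at x)) (at x)"
  by (simp add: frechet_derivative_works)

lemma frechet_derivative_eq:
  "(f has_derivative F) (at x) \<Longrightarrow> frechet_derivative f (at x) = F"
  using frechet_derivative_at by metis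

lemma linear_frechet: "f differentiable (at x) \<Longrightarrow> linear (frechet_derivative f (at x))"
  using has_derivative_frechet has_derivative_linear by blast

section \<open>Closure properties of maps of finite differentiability order\<close>

lemma Ck_on_cong:
  assumes "open U" "\<And>x. x \<in> U \<Longrightarrow> f x = g x" "Ck_on k U f"
  shows "Ck_on k U g"
  using assms(2,3)
proof (induction k arbitrary: f g)
  case 0
  then show ?case using continuous_on_cong[of U U f g] by simp
next
  case (Suc k)
  have *: "frechet_derivative f (at x) = frechet_derivative g (at x)"
    "f differentiable (at x) \<longleftrightarrow> g differentiable (at x)" if "x \<in> U" for x
    using frechet_derivative_cong_open[OF assms(1) that, of f g] Suc.prems(1) by auto
  show ?case
    using Suc.prems(2) Suc.IH[of "\<lambda>x. frechet_derivative f (at x) v" "\<lambda>x. frechet_derivative g (at x) v" for v]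
    by (auto simp: *)
qed

lemma Ck_on_subset: "Ck_on k U f \<Longrightarrow> V \<subseteq> U \<Longrightarrow> Ck_on k V f"
  by (induction k arbitrary: f) (auto intro: continuous_on_subset)

lemma Ck_on_SucD: "Ck_on (Suc k) U f \<Longrightarrow> Ck_on k U f"
proof (induction k arbitrary: f)
  case 0
  then have "f differentiable_on U"
    by (intro differentiable_at_imp_differentiable_on) auto
  then show ?case by (simp add: differentiable_imp_continuous_on)
next
  case (Suc k)
  show ?case using Suc.prems Suc.IH by (auto simp del: Ck_on.simps(1) simp: Ck_on.simps(2)[of k] Ck_on.simps(2)[of "Suc k"])
qed

lemma Ck_on_local:
  assumes "\<And>x. x \<in> U \<Longrightarrow> \<exists>V. open V \<and> x \<in> V \<and> Ck_on k V f"
  shows "Ck_on k U f"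
  using assms
proof (induction k arbitrary: f)
  case 0
  have "continuous (at x) f" if "x \<in> U" for x
    using 0[OF that] continuous_on_eq_continuous_at by force
  then show ?case by (simp add: continuous_at_imp_continuous_on)
next
  case (Suc k)
  have "f differentiable (at x)" if "x \<in> U" for x
    using Suc.prems[OF that] by auto
  moreover have "Ck_on k U (\<lambda>x. frechet_derivative f (at x) v)" for v
  proof (rule Suc.IH)
    fix x assume "x \<in> U"
    with Suc.prems obtain V where "open V" "x \<in> V" "Ck_on (Suc k) V f" by blast
    then show "\<exists>V. open V \<and> x \<in> V \<and> Ck_on k V (\<lambda>x. frechet_derivative f (at x) v)" by auto
  qed
  ultimately show ?case by simp
qed

lemma Ck_on_const: "Ck_on k U (\<lambda>x. c)"
  by (induction k arbitrary: c) auto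

lemma Ck_on_bounded_linear:
  assumes "bounded_linear L" shows "Ck_on k U L"
proof (cases k)
  case 0
  then show ?thesis using assms by (simp add: linear_continuous_on)
next
  case (Suc n)
  have "(L has_derivative L) (at x)" for x using assms by (rule bounded_linear_imp_has_derivative)
  then have "L differentiable (at x)" "frechet_derivative L (at x) = L" for x
    by (auto simp: differentiable_def intro!: frechet_derivative_eq)
  then show ?thesis using Suc by (simp add: Ck_on_const)
qed

lemma Ck_on_add:
  assumes "open U" "Ck_on k U f" "Ck_on k U g"
  shows "Ck_on k U (\<lambda>x. f x + g x)"
  using assms(2,3)
proof (induction k arbitrary: f g)
  case 0 then show ?case by (simp add: continuous_on_add)
next
  case (Suc k)
  have "((\<lambda>x. f x + g x) has_derivative
      (\<lambda>v. frechet_derivative f (at x) v + frechet_derivative g (at x) v)) (at x)" if "x \<in> U" for x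
    using that Suc.prems by (intro has_derivative_add has_derivative_frechet) auto
  note d = this frechet_derivative_eq[OF this]
  have "Ck_on k U (\<lambda>x. frechet_derivative f (at x) v + frechet_derivative g (at x) v)" for v
    using Suc.prems by (intro Suc.IH) auto
  then have "Ck_on k U (\<lambda>x. frechet_derivative (\<lambda>x. f x + g x) (at x) v)" for v
    by (rule Ck_on_cong[OF assms(1), rotated]) (subst d(2), assumption, rule refl)
  then show ?case using differentiableI[OF d(1)] by simp
qed

text \<open>The product rule gives two bilinear terms, each with one undifferentiated factor;
  \<open>Ck_on_SucD\<close> lowers that factor to order \<open>k\<close>, so that the induction
  hypothesis applies to both. A general bounded bilinear map covers products, scalar multiples and
  inner products at once.\<close>

lemma Ck_on_bilinear:
  assumes "open U" "bounded_bilinear B" "Ck_on k U f" "Ck_on k U g"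
  shows "Ck_on k U (\<lambda>x. B (f x) (g x))"
  using assms(3,4)
proof (induction k arbitrary: f g)
  case 0 then show ?case by (simp add: bounded_bilinear.continuous_on[OF assms(2)])
next
  case (Suc k)
  have "((\<lambda>x. B (f x) (g x)) has_derivative
      (\<lambda>v. B (f x) (frechet_derivative g (at x) v) + B (frechet_derivative f (at x) v) (g x))) (at x)"
    if "x \<in> U" for x
    using that Suc.prems by (intro bounded_bilinear.FDERIV[OF assms(2)] has_derivative_frechet) auto
  note d = this frechet_derivative_eq[OF this]
  have "Ck_on k U (\<lambda>x. B (f x) (frechet_derivative g (at x) v))"
    "Ck_on k U (\<lambda>x. B (frechet_derivative f (at x) v) (g x))" for v
    using Suc.prems Suc.prems[THEN Ck_on_SucD] by (auto intro!: Suc.IH simp del: Ck_on.simps(1))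
  note Ck_on_add[OF assms(1) this]
  then have "Ck_on k U (\<lambda>x. frechet_derivative (\<lambda>x. B (f x) (g x)) (at x) v)" for v
    by (rule Ck_on_cong[OF assms(1), rotated]) (subst d(2), assumption, rule refl)
  then show ?case using differentiableI[OF d(1)] by simp
qed

lemma Ck_on_sum:
  assumes "open U" "\<And>i. i \<in> I \<Longrightarrow> Ck_on k U (f i)"
  shows "Ck_on k U (\<lambda>x. \<Sum>i\<in>I. f i x)"
  using assms(2) by (induction I rule: infinite_finite_induct)
    (simp_all add: Ck_on_const Ck_on_add[OF assms(1)])

lemma Ck_on_compose:
  fixes f :: "'e::euclidean_space \<Rightarrow> 'b::real_normed_vector" and g :: "'d::euclidean_space \<Rightarrow> 'e"
  assumes "open U" "open V" "g ` U \<subseteq> V" "Ck_on k V f" "Ck_on k U g"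
  shows "Ck_on k U (\<lambda>x. f (g x))"
  using assms(4,5)
proof (induction k arbitrary: f)
  case 0 then show ?case using assms(3) by (auto intro: continuous_on_compose2)
next
  case (Suc k)
  \<comment> \<open>In the chain rule the direction in which \<open>f\<close> is differentiated
    varies with \<open>x\<close>. Expanding it in the basis leaves fixed directions
    \<open>b\<close>, to which the induction hypothesis applies, with scalar coefficients coming
    from \<open>g\<close>.\<close>
  let ?D = "\<lambda>x v. \<Sum>b\<in>Basis. (frechet_derivative g (at x) v \<bullet> b) *\<^sub>R frechet_derivative f (at (g x)) b"
  have d: "((\<lambda>x. f (g x)) has_derivative ?D x) (at x)" if "x \<in> U" for x
  proof -
    have f: "(f has_derivative frechet_derivative f (at (g x))) (at (g x))"
      using Suc.prems assms(3) that by (intro has_derivative_frechet) auto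
    have l: "linear (frechet_derivative f (at (g x)))" using f has_derivative_linear by blast
    have h: "((\<lambda>x. f (g x)) has_derivative
       (\<lambda>v. frechet_derivative f (at (g x)) (frechet_derivative g (at x) v))) (at x)"
      using Suc.prems that by (intro has_derivative_compose[where f=g and g=f, OF _ f] has_derivative_frechet) auto
    have rep: "frechet_derivative f (at (g x)) w
        = (\<Sum>b\<in>Basis. (w \<bullet> b) *\<^sub>R frechet_derivative f (at (g x)) b)" for w
    proof -
      have "frechet_derivative f (at (g x)) (\<Sum>b\<in>Basis. (w \<bullet> b) *\<^sub>R b)
          = (\<Sum>b\<in>Basis. (w \<bullet> b) *\<^sub>R frechet_derivative f (at (g x)) b)"
        by (simp only: linear_sum[OF l] linear_cmul[OF l])
      then show ?thesis by (simp only: euclidean_representation)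
    qed
    show ?thesis by (rule has_derivative_eq_rhs[OF h]) (rule ext, rule rep)
  qed
  have g: "Ck_on k U g" using Suc.prems Ck_on_SucD by blast
  have "Ck_on k U (\<lambda>x. (frechet_derivative g (at x) v \<bullet> b) *\<^sub>R frechet_derivative f (at (g x)) b)" for v b
    using Suc.IH[of "\<lambda>y. frechet_derivative f (at y) b"] Suc.prems Ck_on_const[of k U b] g
    by (intro Ck_on_bilinear[OF assms(1) bounded_bilinear_scaleR]
        Ck_on_bilinear[OF assms(1) bounded_bilinear_inner]) (auto simp: Ck_on_const)
  then have "Ck_on k U (\<lambda>x. ?D x v)" for v by (intro Ck_on_sum[OF assms(1)])
  then have "Ck_on k U (\<lambda>x. frechet_derivative (\<lambda>x. f (g x)) (at x) v)" for v
    by (rule Ck_on_cong[OF assms(1), rotated]) (subst frechet_derivative_eq[OF d], assumption, rule refl)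
  moreover have "(\<lambda>x. f (g x)) differentiable (at x)" if "x \<in> U" for x
    using d[OF that] by (rule differentiableI)
  ultimately show ?case unfolding Ck_on.simps(2) by (intro conjI ballI allI)
qed

section \<open>The same closure properties for smooth maps\<close>

lemma smooth_on_cong: "open U \<Longrightarrow> (\<And>x. x \<in> U \<Longrightarrow> f x = g x) \<Longrightarrow> smooth_on U f \<Longrightarrow> smooth_on U g"
  unfolding smooth_on_def using Ck_on_cong by blast

lemma smooth_on_subset: "smooth_on U f \<Longrightarrow> V \<subseteq> U \<Longrightarrow> smooth_on V f"
  unfolding smooth_on_def using Ck_on_subset by blast

lemma smooth_on_local:
  "(\<And>x. x \<in> U \<Longrightarrow> \<exists>V. open V \<and> x \<in> V \<and> smooth_on V f) \<Longrightarrow> smooth_on U f"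
  unfolding smooth_on_def by (intro allI Ck_on_local) blast

lemma smooth_on_const: "smooth_on U (\<lambda>x. c)"
  unfolding smooth_on_def using Ck_on_const by blast

lemma smooth_on_bounded_linear: "bounded_linear L \<Longrightarrow> smooth_on U L"
  unfolding smooth_on_def using Ck_on_bounded_linear by blast

lemma smooth_on_add: "open U \<Longrightarrow> smooth_on U f \<Longrightarrow> smooth_on U g \<Longrightarrow> smooth_on U (\<lambda>x. f x + g x)"
  unfolding smooth_on_def using Ck_on_add by blast

lemma smooth_on_bilinear:
  "open U \<Longrightarrow> bounded_bilinear B \<Longrightarrow> smooth_on U f \<Longrightarrow> smooth_on U g \<Longrightarrow> smooth_on U (\<lambda>x. B (f x) (g x))"
  unfolding smooth_on_def using Ck_on_bilinear by blast

lemmas smooth_on_mult = smooth_on_bilinear[OF _ bounded_bilinear_mult]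
lemmas smooth_on_scaleR = smooth_on_bilinear[OF _ bounded_bilinear_scaleR]

lemma smooth_on_sum:
  "open U \<Longrightarrow> (\<And>i. i \<in> I \<Longrightarrow> smooth_on U (f i)) \<Longrightarrow> smooth_on U (\<lambda>x. \<Sum>i\<in>I. f i x)"
  unfolding smooth_on_def by (auto intro!: Ck_on_sum)

lemma smooth_on_compose:
  fixes f :: "'e::euclidean_space \<Rightarrow> 'b::real_normed_vector" and g :: "'d::euclidean_space \<Rightarrow> 'e"
  shows "open U \<Longrightarrow> open V \<Longrightarrow> g ` U \<subseteq> V \<Longrightarrow> smooth_on V f \<Longrightarrow> smooth_on U g \<Longrightarrow> smooth_on U (\<lambda>x. f (g x))"
  unfolding smooth_on_def using Ck_on_compose by blast

lemma smooth_on_differentiable: "smooth_on U f \<Longrightarrow> x \<in> U \<Longrightarrow> f differentiable (at x)"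
  unfolding smooth_on_def using Ck_on.simps(2) by metis

lemma smooth_on_frechet: "smooth_on U f \<Longrightarrow> smooth_on U (\<lambda>x. frechet_derivative f (at x) v)"
  unfolding smooth_on_def using Ck_on.simps(2) by metis

lemma smooth_on_linear_compose:
  fixes f :: "'d::euclidean_space \<Rightarrow> 'e::euclidean_space"
  assumes "open U" "bounded_linear L" "smooth_on U f"
  shows "smooth_on U (\<lambda>x. L (f x))"
  using smooth_on_compose[OF assms(1) open_UNIV _ smooth_on_bounded_linear[OF assms(2)] assms(3)] by simp

lemma smooth_on_vec_iff:
  fixes f :: "'d::euclidean_space \<Rightarrow> real^'n"
  assumes "open U"
  shows "smooth_on U f \<longleftrightarrow> (\<forall>i. smooth_on U (\<lambda>x. f x $ i))"
proof
  assume "smooth_on U f"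
  then show "\<forall>i. smooth_on U (\<lambda>x. f x $ i)"
    using smooth_on_linear_compose[OF assms bounded_linear_vec_nth] by blast
next
  assume *: "\<forall>i. smooth_on U (\<lambda>x. f x $ i)"
  have "smooth_on U (\<lambda>x. \<Sum>i\<in>UNIV. (f x $ i) *\<^sub>R axis i (1::real))"
    using * by (intro smooth_on_sum[OF assms] smooth_on_scaleR[OF assms] smooth_on_const) auto
  moreover have "(\<Sum>i\<in>UNIV. (f x $ i) *\<^sub>R axis i (1::real)) = f x" for x
    using basis_expansion[of "f x"] by (simp add: scalar_mult_eq_scaleR)
  ultimately show "smooth_on U f" by simp
qed

lemma linear_axis_expansion:
  fixes L :: "real^'n \<Rightarrow> 'b::real_vector"
  assumes "linear L"
  shows "L w = (\<Sum>i\<in>UNIV. w $ i *\<^sub>R L (axis i 1))"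
proof -
  have "L (\<Sum>i\<in>UNIV. w $ i *\<^sub>R axis i 1) = (\<Sum>i\<in>UNIV. w $ i *\<^sub>R L (axis i 1))"
    by (simp only: linear_sum[OF assms] linear_cmul[OF assms])
  then show ?thesis using basis_expansion[of w] by (simp add: scalar_mult_eq_scaleR)
qed

lemma coord_bilinear_axis:
  "(\<Sum>i\<in>UNIV. \<Sum>j\<in>UNIV. M i j * axis a 1 $ i * axis b 1 $ (j::2)) = (M a b :: real)" for a b :: 2
  using exhaust_2[of a] exhaust_2[of b] by (auto simp: sum_2 axis_def)

section \<open>Charts and smooth functions\<close>

lemma components_add [simp]: "components c (u + v) = components c u + components c v"
  by (simp add: components_def vec_eq_iff)

lemma components_diff [simp]: "components c (u - v) = components c u - components c v"
  by (simp add: components_def vec_eq_iff)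

lemma components_scale [simp]: "components c (vscale r v) = r *\<^sub>R components c v"
  by (simp add: components_def vec_eq_iff vscale_def)

lemma components_zero [simp]: "components c 0 = 0"
  by (simp add: components_def vec_eq_iff)

lemma vscale_simps: "vscale r 0 = 0" "vscale 0 v = 0" "vscale 1 v = v" "u + vscale (-1) v = u - v"
  "vscale r (vscale s v) = vscale (r * s) v" "vscale r (u + v) = vscale r u + vscale r v"
  "vscale r (u - v) = vscale r u - vscale r v" "vscale (r + s) v = vscale r v + vscale s v"
  by (auto simp: vscale_def fun_eq_iff algebra_simps)

lemma field_scale_apply: "field_scale f X p = vscale (f p) (X p)"
  by (simp add: field_scale_def)

text \<open>Expresses a difference through the two operations that the axioms of a connection speak
  about.\<close>

lemma diff_field: "X - Y = X + field_scale (\<lambda>q. -1) (Y :: 'a vfield)"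
  by (auto simp: fun_eq_iff field_scale_def vscale_def)

locale smooth_surface =
  fixes A :: "'a::{t2_space, second_countable_topology} chart set"
  assumes surface: "surface A"
begin

abbreviation im :: "'a chart \<Rightarrow> 'a set \<Rightarrow> (real^2) set" where
  "im c W \<equiv> chart_map c ` (chart_dom c \<inter> W)"

lemma ex_chart: obtains c where "c \<in> A" "p \<in> chart_dom c"
  using surface unfolding surface_def by blast

lemma chart_at: "chart_at A p \<in> A" "p \<in> chart_dom (chart_at A p)"
proof -
  obtain c where "c \<in> A \<and> p \<in> chart_dom c" using ex_chart[of p] by blast
  then have "chart_at A p \<in> A \<and> p \<in> chart_dom (chart_at A p)" unfolding chart_at_def by (rule someI)
  then show "chart_at A p \<in> A" "p \<in> chart_dom (chart_at A p)" by auto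
qed

lemma is_chart: "c \<in> A \<Longrightarrow> is_chart c"
  using surface unfolding surface_def by blast

lemma open_dom: "c \<in> A \<Longrightarrow> open (chart_dom c)"
  using is_chart unfolding is_chart_def by blast

lemma inv_map [simp]: "c \<in> A \<Longrightarrow> p \<in> chart_dom c \<Longrightarrow> chart_inv c (chart_map c p) = p"
  using is_chart homeomorphism_apply1 unfolding is_chart_def by blast

lemma imE:
  assumes "x \<in> im c W" "c \<in> A"
  shows "chart_inv c x \<in> chart_dom c" "chart_inv c x \<in> W" "chart_map c (chart_inv c x) = x"
  using assms by auto

lemma open_im:
  assumes "c \<in> A" "open W" shows "open (im c W)"
proof -
  have h: "homeomorphism (chart_dom c) (chart_map c ` chart_dom c) (chart_map c) (chart_inv c)"
    and o: "open (chart_map c ` chart_dom c)"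
    using is_chart[OF assms(1)] unfolding is_chart_def by auto
  have "openin (top_of_set (chart_map c ` chart_dom c)) (im c W)"
    by (rule homeomorphism_imp_open_map[OF h]) (use assms in \<open>auto simp: openin_open\<close>)
  then show ?thesis using o openin_open_trans by blast
qed

lemma map_im: "p \<in> chart_dom c \<Longrightarrow> p \<in> W \<Longrightarrow> chart_map c p \<in> im c W" by auto

lemma smooth_transition: "c \<in> A \<Longrightarrow> d \<in> A \<Longrightarrow> smooth_on (im c (chart_dom d)) (transition c d)"
  using surface unfolding surface_def by blast

lemma smooth_funD: "smooth_fun A W f \<Longrightarrow> c \<in> A \<Longrightarrow> smooth_on (im c W) (\<lambda>x. f (chart_inv c x))"
  unfolding smooth_fun_def comp_def by blast

lemma smooth_funI: "(\<And>c. c \<in> A \<Longrightarrow> smooth_on (im c W) (\<lambda>x. f (chart_inv c x))) \<Longrightarrow> smooth_fun A W f"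
  unfolding smooth_fun_def comp_def by blast

lemma smooth_fun_subset: "smooth_fun A W f \<Longrightarrow> V \<subseteq> W \<Longrightarrow> smooth_fun A V f"
  unfolding smooth_fun_def by (blast intro: smooth_on_subset)

lemma smooth_fun_cong:
  assumes "open W" "\<And>p. p \<in> W \<Longrightarrow> f p = g p" "smooth_fun A W f"
  shows "smooth_fun A W g"
proof (rule smooth_funI)
  fix c assume c: "c \<in> A"
  show "smooth_on (im c W) (\<lambda>x. g (chart_inv c x))"
    by (rule smooth_on_cong[OF open_im[OF c assms(1)] _ smooth_funD[OF assms(3) c]])
      (use assms(2) imE(2)[OF _ c] in blast)
qed

lemma smooth_fun_local:
  assumes "\<And>p. p \<in> W \<Longrightarrow> \<exists>V. open V \<and> p \<in> V \<and> smooth_fun A V f"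
  shows "smooth_fun A W f"
proof (intro smooth_funI smooth_on_local)
  fix c x assume c: "c \<in> A" and x: "x \<in> im c W"
  then obtain p where p: "p \<in> chart_dom c" "p \<in> W" "x = chart_map c p" by auto
  with assms obtain V where "open V" "p \<in> V" "smooth_fun A V f" by blast
  then show "\<exists>V. open V \<and> x \<in> V \<and> smooth_on V (\<lambda>x. f (chart_inv c x))"
    using c p open_im smooth_funD by (intro exI[of _ "im c V"]) auto
qed

lemma smooth_fun_const: "smooth_fun A W (\<lambda>q. r)"
  by (intro smooth_funI smooth_on_const)

lemma smooth_fun_add:
  assumes "open W" "smooth_fun A W f" "smooth_fun A W g"
  shows "smooth_fun A W (\<lambda>q. f q + g q)"
  by (rule smooth_funI, rule smooth_on_add, rule open_im) (use assms in \<open>blast intro: smooth_funD\<close>)+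

lemma smooth_fun_mult:
  assumes "open W" "smooth_fun A W f" "smooth_fun A W g"
  shows "smooth_fun A W (\<lambda>q. f q * g q)"
  by (rule smooth_funI, rule smooth_on_mult, rule open_im) (use assms in \<open>blast intro: smooth_funD\<close>)+

lemma smooth_fun_sum:
  assumes "open W" "\<And>i. i \<in> I \<Longrightarrow> smooth_fun A W (f i)"
  shows "smooth_fun A W (\<lambda>q. \<Sum>i\<in>I. f i q)"
  by (rule smooth_funI, rule smooth_on_sum, rule open_im) (use assms in \<open>blast intro: smooth_funD\<close>)+

lemma transition_im:
  assumes "c \<in> A" "d \<in> A" "W \<subseteq> chart_dom c"
  shows "transition d c ` im d W \<subseteq> im c W"
  using assms by (auto simp: transition_def)

text \<open>Every other chart reads \<open>f\<close> as the expression in \<open>c\<close> composed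
  with a transition map, so a single convenient chart is enough to test smoothness.\<close>

lemma smooth_fun_chart:
  assumes c: "c \<in> A" and W: "open W" "W \<subseteq> chart_dom c"
    and f: "smooth_on (im c W) (\<lambda>x. f (chart_inv c x))"
  shows "smooth_fun A W f"
proof (rule smooth_funI)
  fix d assume d: "d \<in> A"
  have "smooth_on (im d W) (\<lambda>x. f (chart_inv c (transition d c x)))"
    using W by (intro smooth_on_compose[OF open_im[OF d W(1)] open_im[OF c W(1)] transition_im[OF c d W(2)] f]
      smooth_on_subset[OF smooth_transition[OF d c]]) auto
  then show "smooth_on (im d W) (\<lambda>x. f (chart_inv d x))"
    by (rule smooth_on_cong[OF open_im[OF d W(1)], rotated])
      (use W c d in \<open>auto simp: transition_def\<close>)
qed

lemma smooth_fun_coord: 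
  assumes "c \<in> A" shows "smooth_fun A (chart_dom c) (\<lambda>q. chart_map c q $ i)"
proof (rule smooth_fun_chart[OF assms open_dom[OF assms] order_refl])
  show "smooth_on (im c (chart_dom c)) (\<lambda>x. chart_map c (chart_inv c x) $ i)"
    by (rule smooth_on_cong[OF open_im[OF assms open_dom[OF assms]] _
          smooth_on_bounded_linear[OF bounded_linear_vec_nth]])
      (use assms in auto)
qed

lemma smooth_atI: "open W \<Longrightarrow> p \<in> W \<Longrightarrow> smooth_fun A W f \<Longrightarrow> smooth_at A p f"
  unfolding smooth_at_def by blast

lemma smooth_at_cong_imp:
  assumes "open W" "p \<in> W" "\<And>q. q \<in> W \<Longrightarrow> f q = g q" "smooth_at A p f"
  shows "smooth_at A p g"
proof -
  obtain V where V: "open V" "p \<in> V" "smooth_fun A V f" using assms(4) unfolding smooth_at_def by blast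
  have "smooth_fun A (W \<inter> V) g"
    by (rule smooth_fun_cong[OF _ _ smooth_fun_subset[OF V(3)]]) (use assms V in auto)
  then show ?thesis using assms V by (intro smooth_atI[of "W \<inter> V"]) auto
qed

lemma smooth_at_cong:
  assumes "open W" "p \<in> W" "\<And>q. q \<in> W \<Longrightarrow> f q = g q"
  shows "smooth_at A p f \<longleftrightarrow> smooth_at A p g"
  using smooth_at_cong_imp[of W p f g] smooth_at_cong_imp[of W p g f] assms by metis

lemma smooth_at_binop:
  assumes "\<And>W f g. open W \<Longrightarrow> smooth_fun A W f \<Longrightarrow> smooth_fun A W g \<Longrightarrow> smooth_fun A W (B f g)"
    and "smooth_at A p f" "smooth_at A p g"
  shows "smooth_at A p (B f g)"
proof -
  obtain V W where "open V" "p \<in> V" "smooth_fun A V f" "open W" "p \<in> W" "smooth_fun A W g"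
    using assms(2,3) unfolding smooth_at_def by blast
  then show ?thesis
    by (intro smooth_atI[of "V \<inter> W"] assms(1)) (auto intro: smooth_fun_subset)
qed

lemma smooth_at_add: "smooth_at A p f \<Longrightarrow> smooth_at A p g \<Longrightarrow> smooth_at A p (\<lambda>q. f q + g q)"
  by (rule smooth_at_binop[where B = "\<lambda>f g q. f q + g q"]) (auto intro: smooth_fun_add)

lemma smooth_at_mult: "smooth_at A p f \<Longrightarrow> smooth_at A p g \<Longrightarrow> smooth_at A p (\<lambda>q. f q * g q)"
  by (rule smooth_at_binop[where B = "\<lambda>f g q. f q * g q"]) (auto intro: smooth_fun_mult)

lemma smooth_at_coord: "c \<in> A \<Longrightarrow> p \<in> chart_dom c \<Longrightarrow> smooth_at A p (\<lambda>q. chart_map c q $ i)"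
  using smooth_atI open_dom smooth_fun_coord by blast

lemma smooth_at_differentiable:
  assumes "smooth_at A p f" "c \<in> A" "p \<in> chart_dom c"
  shows "(\<lambda>x. f (chart_inv c x)) differentiable (at (chart_map c p))"
proof -
  obtain W where "open W" "p \<in> W" "smooth_fun A W f" using assms unfolding smooth_at_def by blast
  then show ?thesis using assms by (intro smooth_on_differentiable[OF smooth_funD]) auto
qed

section \<open>Tangent vectors\<close>

lemma coord_vec_apply:
  "smooth_at A p f \<Longrightarrow>
   coord_vec A c p w f = frechet_derivative (\<lambda>x. f (chart_inv c x)) (at (chart_map c p)) w"
  by (simp add: coord_vec_def comp_def)

lemma components_coord_vec [simp]:
  assumes "c \<in> A" "p \<in> chart_dom c"
  shows "components c (coord_vec A c p w) = w"
proof -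
  have "frechet_derivative (\<lambda>x. chart_map c (chart_inv c x) $ i) (at (chart_map c p))
      = frechet_derivative (\<lambda>x. x $ i) (at (chart_map c p))" for i
    by (rule frechet_derivative_cong_open[OF open_im[OF assms(1) open_UNIV]]) (use assms in auto)
  also have "\<dots> i = (\<lambda>x. x $ i)" for i
    by (intro frechet_derivative_eq bounded_linear_imp_has_derivative bounded_linear_vec_nth)
  finally show ?thesis
    by (simp add: components_def coord_vec_apply[OF smooth_at_coord[OF assms]])
qed

text \<open>The chain rule for \<open>f\<close> read in \<open>d\<close>, composed with the
  transition map. On functions that are not smooth at \<open>p\<close> both sides are zero by the
  convention in \<open>coord_vec\<close>.\<close>

lemma coord_vec_change:
  assumes c: "c \<in> A" "p \<in> chart_dom c" and d: "d \<in> A" "p \<in> chart_dom d"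
  shows "coord_vec A c p w = coord_vec A d p (frechet_derivative (transition c d) (at (chart_map c p)) w)"
proof
  fix f
  show "coord_vec A c p w f = coord_vec A d p (frechet_derivative (transition c d) (at (chart_map c p)) w) f"
  proof (cases "smooth_at A p f")
    case True
    let ?x = "chart_map c p" and ?F = "\<lambda>x. f (chart_inv d x)"
    have tx: "transition c d ?x = chart_map d p" using c by (simp add: transition_def)
    have "(?F has_derivative frechet_derivative ?F (at (chart_map d p))) (at (transition c d ?x))"
      unfolding tx by (intro has_derivative_frechet smooth_at_differentiable True d)
    moreover have "transition c d differentiable (at ?x)"
      by (rule smooth_on_differentiable[OF smooth_transition[OF c(1) d(1)]]) (use c d in auto)
    ultimately have "((\<lambda>x. ?F (transition c d x)) has_derivative (\<lambda>w. frechet_derivative ?F (at (chart_map d p))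
        (frechet_derivative (transition c d) (at ?x) w))) (at ?x)"
      using has_derivative_compose has_derivative_frechet by blast
    then have "frechet_derivative (\<lambda>x. ?F (transition c d x)) (at ?x) w
       = frechet_derivative ?F (at (chart_map d p)) (frechet_derivative (transition c d) (at ?x) w)"
      using frechet_derivative_eq by metis
    moreover have "frechet_derivative (\<lambda>x. ?F (transition c d x)) (at ?x)
       = frechet_derivative (\<lambda>x. f (chart_inv c x)) (at ?x)"
      by (rule frechet_derivative_cong_open[OF open_im[OF c(1) open_dom[OF d(1)]]])
        (use c d in \<open>auto simp: transition_def\<close>)
    ultimately show ?thesis using True by (simp add: coord_vec_apply)
  qed (simp add: coord_vec_def)
qed

text \<open>\<open>coord_vec_change\<close> rewrites the vector from the chart in which it was given
  to \<open>c\<close>, where \<open>components\<close> inverts \<open>coord_vec\<close>. Tangent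
  vectors can thus be handled through their components in any chart.\<close>

lemma tangent_rep:
  assumes "v \<in> tangent_space A p" "c \<in> A" "p \<in> chart_dom c"
  shows "coord_vec A c p (components c v) = v"
proof -
  obtain d w where "d \<in> A" "p \<in> chart_dom d" "v = coord_vec A d p w"
    using assms(1) unfolding tangent_space_def by blast
  with coord_vec_change[of d p c w] obtain w' where "v = coord_vec A c p w'" using assms by metis
  then show ?thesis using assms by simp
qed

lemma coord_vec_tangent: "c \<in> A \<Longrightarrow> p \<in> chart_dom c \<Longrightarrow> coord_vec A c p w \<in> tangent_space A p"
  unfolding tangent_space_def by blast

lemma linear_coord_frechet:
  assumes "smooth_at A p f" "c \<in> A" "p \<in> chart_dom c"
  shows "linear (frechet_derivative (\<lambda>x. f (chart_inv c x)) (at (chart_map c p)))"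
  using assms by (intro linear_frechet smooth_at_differentiable)

lemma coord_vec_add:
  assumes "c \<in> A" "p \<in> chart_dom c"
  shows "coord_vec A c p (u + w) = coord_vec A c p u + coord_vec A c p w"
  using linear_add[OF linear_coord_frechet[OF _ assms]] by (auto simp: coord_vec_def comp_def fun_eq_iff)

lemma coord_vec_scale:
  assumes "c \<in> A" "p \<in> chart_dom c"
  shows "coord_vec A c p (r *\<^sub>R w) = vscale r (coord_vec A c p w)"
  using linear_cmul[OF linear_coord_frechet[OF _ assms]]
  by (auto simp: coord_vec_def comp_def fun_eq_iff vscale_def)

lemma tangent_add:
  assumes "u \<in> tangent_space A p" "v \<in> tangent_space A p"
  shows "u + v \<in> tangent_space A p"
proof -
  obtain c where "c \<in> A" "p \<in> chart_dom c" using ex_chart by blast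
  then show ?thesis using tangent_rep assms coord_vec_add coord_vec_tangent by metis
qed

lemma tangent_scale:
  assumes "u \<in> tangent_space A p"
  shows "vscale r u \<in> tangent_space A p"
proof -
  obtain c where "c \<in> A" "p \<in> chart_dom c" using ex_chart by blast
  then show ?thesis using tangent_rep assms coord_vec_scale coord_vec_tangent by metis
qed

lemma tangentE:
  assumes "v \<in> tangent_space A p"
  obtains c w where "c \<in> A" "p \<in> chart_dom c" "v = coord_vec A c p w"
  using assms unfolding tangent_space_def by blast

text \<open>Locality is needed twice: for the derivative, and for the test \<open>smooth_at\<close>
  that decides between the derivative and the default value 0.\<close>

lemma tvec_local:
  assumes "v \<in> tangent_space A p" "open W" "p \<in> W" "\<And>q. q \<in> W \<Longrightarrow> f q = g q"
  shows "v f = v g"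
proof -
  obtain c w where c: "c \<in> A" "p \<in> chart_dom c" "v = coord_vec A c p w"
    using assms(1) by (rule tangentE)
  have "frechet_derivative (\<lambda>x. f (chart_inv c x)) (at (chart_map c p))
      = frechet_derivative (\<lambda>x. g (chart_inv c x)) (at (chart_map c p))"
    by (rule frechet_derivative_cong_open[OF open_im[OF c(1) assms(2)]]) (use assms c in auto)
  then show ?thesis using smooth_at_cong[OF assms(2,3,4)] by (simp add: c(3) coord_vec_def comp_def)
qed

lemma tvec_nonsmooth: "v \<in> tangent_space A p \<Longrightarrow> \<not> smooth_at A p f \<Longrightarrow> v f = 0"
  by (auto simp: tangent_space_def coord_vec_def)

lemma tvec_const:
  assumes "v \<in> tangent_space A p" shows "v (\<lambda>q. r) = 0"
  using assms by (rule tangentE) (simp add: coord_vec_def comp_def)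

lemma tvec_add:
  assumes "v \<in> tangent_space A p" "smooth_at A p f" "smooth_at A p g"
  shows "v (\<lambda>q. f q + g q) = v f + v g"
proof -
  obtain c w where c: "c \<in> A" "p \<in> chart_dom c" "v = coord_vec A c p w"
    using assms(1) by (rule tangentE)
  note d = has_derivative_frechet[OF smooth_at_differentiable[OF assms(2) c(1,2)]]
    has_derivative_frechet[OF smooth_at_differentiable[OF assms(3) c(1,2)]]
  show ?thesis
    using frechet_derivative_eq[OF has_derivative_add[OF d]] smooth_at_add[OF assms(2,3)] assms
    by (simp add: c(3) coord_vec_apply)
qed

lemma tvec_mult:
  assumes "v \<in> tangent_space A p" "smooth_at A p f" "smooth_at A p g"
  shows "v (\<lambda>q. f q * g q) = f p * v g + v f * g p"
proof -
  obtain c w where c: "c \<in> A" "p \<in> chart_dom c" "v = coord_vec A c p w"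
    using assms(1) by (rule tangentE)
  note d = has_derivative_frechet[OF smooth_at_differentiable[OF assms(2) c(1,2)]]
    has_derivative_frechet[OF smooth_at_differentiable[OF assms(3) c(1,2)]]
  show ?thesis
    using frechet_derivative_eq[OF has_derivative_mult[OF d]] smooth_at_mult[OF assms(2,3)] assms
    by (simp add: c coord_vec_apply)
qed

lemma tvec_cmult:
  assumes "v \<in> tangent_space A p" "smooth_at A p f"
  shows "v (\<lambda>q. r * f q) = r * v f"
  using tvec_mult[OF assms(1) smooth_atI[OF open_UNIV _ smooth_fun_const, of p r] assms(2)]
    tvec_const[OF assms(1)] by simp

end

section \<open>Vector fields\<close>

context smooth_surface begin

lemma smooth_field_tangent: "smooth_field A W X \<Longrightarrow> p \<in> W \<Longrightarrow> X p \<in> tangent_space A p"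
  unfolding smooth_field_def by blast

lemma smooth_field_components:
  assumes "open W" "smooth_field A W X" "c \<in> A"
  shows "smooth_fun A (W \<inter> chart_dom c) (\<lambda>p. components c (X p) $ i)"
proof (rule smooth_fun_chart[OF assms(3)])
  show "open (W \<inter> chart_dom c)" using assms open_dom by blast
  have "smooth_on (im c W) (\<lambda>x. components c (X (chart_inv c x)))"
    using assms unfolding smooth_field_def by blast
  then have "smooth_on (im c W) (\<lambda>x. components c (X (chart_inv c x)) $ i)"
    by (simp add: smooth_on_vec_iff[OF open_im[OF assms(3,1)]])
  then show "smooth_on (im c (W \<inter> chart_dom c)) (\<lambda>x. components c (X (chart_inv c x)) $ i)"
    by (rule smooth_on_subset) auto
qed auto

text \<open>The components in another chart \<open>d\<close> are those in \<open>c\<close>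
  multiplied by the Jacobian of the transition map, whose entries are smooth; one chart around each
  point therefore suffices.\<close>

lemma smooth_fieldI:
  assumes W: "open W" and t: "\<And>p. p \<in> W \<Longrightarrow> X p \<in> tangent_space A p"
    and s: "\<And>p. p \<in> W \<Longrightarrow> \<exists>c\<in>A. p \<in> chart_dom c \<and>
      (\<forall>i. smooth_fun A (W \<inter> chart_dom c) (\<lambda>q. components c (X q) $ i))"
  shows "smooth_field A W X"
  unfolding smooth_field_def
proof (intro conjI ballI smooth_on_local t)
  fix d x assume d: "d \<in> A" and "x \<in> im d W"
  then obtain p where p: "p \<in> chart_dom d" "p \<in> W" "x = chart_map d p" by auto
  from s[OF p(2)] obtain c where c: "c \<in> A" "p \<in> chart_dom c"
    "\<And>i. smooth_fun A (W \<inter> chart_dom c) (\<lambda>q. components c (X q) $ i)" by blast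
  let ?V = "im d (W \<inter> chart_dom c)" and ?F = "\<lambda>y i. frechet_derivative (transition c d) (at y) (axis i 1)"
  have V: "open ?V" using open_im[OF d] W open_dom[OF c(1)] by blast
  have "smooth_on ?V (\<lambda>x. ?F (transition d c x) i)" for i
    by (rule smooth_on_compose[where f = "\<lambda>y. ?F y i", OF V open_im[OF c(1) open_dom[OF d]] _
        smooth_on_frechet[OF smooth_transition[OF c(1) d]]
        smooth_on_subset[OF smooth_transition[OF d c(1)]]])
      (use c d in \<open>auto simp: transition_def\<close>)
  then have sm: "smooth_on ?V (\<lambda>x. \<Sum>i\<in>UNIV. components c (X (chart_inv d x)) $ i *\<^sub>R ?F (transition d c x) i)"
    by (intro smooth_on_sum[OF V] smooth_on_scaleR[OF V] smooth_funD[OF c(3) d])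
  have eq: "components d (X (chart_inv d y)) =
     (\<Sum>i\<in>UNIV. components c (X (chart_inv d y)) $ i *\<^sub>R ?F (transition d c y) i)" if "y \<in> ?V" for y
  proof -
    obtain q where q: "q \<in> chart_dom d" "q \<in> W" "q \<in> chart_dom c" "y = chart_map d q" using \<open>y \<in> ?V\<close> by blast
    have tr: "transition d c y = chart_map c q" using q d by (simp add: transition_def)
    have "components d (X q) = components d (coord_vec A c q (components c (X q)))"
      using tangent_rep[OF t c(1)] q by simp
    also have "\<dots> = frechet_derivative (transition c d) (at (chart_map c q)) (components c (X q))"
      using coord_vec_change[OF c(1) q(3) d q(1)] components_coord_vec[OF d q(1)] by simp
    also have "\<dots> = (\<Sum>i\<in>UNIV. components c (X q) $ i *\<^sub>R ?F (chart_map c q) i)"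
      by (intro linear_axis_expansion linear_frechet
          smooth_on_differentiable[OF smooth_transition[OF c(1) d]] map_im q)
    finally show ?thesis using q d tr by simp
  qed
  have "smooth_on ?V (\<lambda>x. components d (X (chart_inv d x)))"
    by (rule smooth_on_cong[OF V _ sm]) (rule eq[symmetric])
  then show "\<exists>V. open V \<and> x \<in> V \<and> smooth_on V (\<lambda>x. components d (X (chart_inv d x)))"
    using V p c by (intro exI[of _ ?V]) auto
qed

lemma smooth_field_subset: "smooth_field A W X \<Longrightarrow> V \<subseteq> W \<Longrightarrow> smooth_field A V X"
  unfolding smooth_field_def using smooth_on_subset by (meson Int_mono image_mono order_refl subsetD)

lemma smooth_field_cong:
  assumes "open W" "\<And>p. p \<in> W \<Longrightarrow> X p = Y p" "smooth_field A W X"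
  shows "smooth_field A W Y"
proof (rule smooth_fieldI[OF assms(1)])
  fix p assume p: "p \<in> W"
  then show "Y p \<in> tangent_space A p" using assms smooth_field_tangent by metis
  obtain c where c: "c \<in> A" "p \<in> chart_dom c" by (rule ex_chart)
  have "smooth_fun A (W \<inter> chart_dom c) (\<lambda>q. components c (Y q) $ i)" for i
    by (rule smooth_fun_cong[OF _ _ smooth_field_components[OF assms(1,3) c(1)]])
      (use assms open_dom[OF c(1)] in auto)
  then show "\<exists>c\<in>A. p \<in> chart_dom c \<and> (\<forall>i. smooth_fun A (W \<inter> chart_dom c) (\<lambda>q. components c (Y q) $ i))"
    using c by blast
qed

lemma smooth_field_add:
  assumes "open W" "smooth_field A W X" "smooth_field A W Y"
  shows "smooth_field A W (X + Y)"
proof (rule smooth_fieldI[OF assms(1)])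
  fix p assume p: "p \<in> W"
  then show "(X + Y) p \<in> tangent_space A p" using assms smooth_field_tangent tangent_add by simp
  obtain c where c: "c \<in> A" "p \<in> chart_dom c" by (rule ex_chart)
  then show "\<exists>c\<in>A. p \<in> chart_dom c \<and> (\<forall>i. smooth_fun A (W \<inter> chart_dom c) (\<lambda>q. components c ((X + Y) q) $ i))"
    using assms open_dom[OF c(1)]
    by (auto intro!: bexI[of _ c] smooth_fun_add smooth_field_components)
qed

lemma smooth_field_scale:
  assumes "open W" "smooth_fun A W f" "smooth_field A W X"
  shows "smooth_field A W (field_scale f X)"
proof (rule smooth_fieldI[OF assms(1)])
  fix p assume p: "p \<in> W"
  then show "field_scale f X p \<in> tangent_space A p"
    using assms smooth_field_tangent tangent_scale by (simp add: field_scale_def)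
  obtain c where c: "c \<in> A" "p \<in> chart_dom c" by (rule ex_chart)
  then show "\<exists>c\<in>A. p \<in> chart_dom c \<and> (\<forall>i. smooth_fun A (W \<inter> chart_dom c) (\<lambda>q. components c (field_scale f X q) $ i))"
    using assms open_dom[OF c(1)] unfolding field_scale_def
    by (auto intro!: bexI[of _ c] smooth_fun_mult smooth_field_components intro: smooth_fun_subset)
qed

lemma smooth_field_diff:
  "open W \<Longrightarrow> smooth_field A W X \<Longrightarrow> smooth_field A W Y \<Longrightarrow> smooth_field A W (X - Y)"
  unfolding diff_field by (intro smooth_field_add smooth_field_scale smooth_fun_const)

lemma smooth_field_const:
  assumes "c \<in> A" shows "smooth_field A (chart_dom c) (\<lambda>p. coord_vec A c p w)"
proof (rule smooth_fieldI[OF open_dom[OF assms]])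
  fix p assume p: "p \<in> chart_dom c"
  show "coord_vec A c p w \<in> tangent_space A p" using assms p by (rule coord_vec_tangent)
  have "smooth_fun A (chart_dom c \<inter> chart_dom c) (\<lambda>q. components c (coord_vec A c q w) $ i)" for i
    by (rule smooth_fun_cong[OF _ _ smooth_fun_const[of _ "w $ i"]])
      (use open_dom[OF assms] assms in auto)
  then show "\<exists>d\<in>A. p \<in> chart_dom d \<and>
      (\<forall>i. smooth_fun A (chart_dom c \<inter> chart_dom d) (\<lambda>q. components d (coord_vec A c q w) $ i))"
    using assms p by blast
qed

lemma smooth_field_coord: "c \<in> A \<Longrightarrow> W \<subseteq> chart_dom c \<Longrightarrow> smooth_field A W (coord_field A c i)"
  unfolding coord_field_def using smooth_field_const smooth_field_subset by blast

lemma components_coord_field [simp]: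
  "c \<in> A \<Longrightarrow> p \<in> chart_dom c \<Longrightarrow> components c (coord_field A c i p) = axis i 1"
  by (simp add: coord_field_def)

lemma coord_vec_expand:
  assumes "c \<in> A" "p \<in> chart_dom c"
  shows "coord_vec A c p w = vscale (w $ 1) (coord_field A c 1 p) + vscale (w $ 2) (coord_field A c 2 p)"
proof -
  have "w = w $ 1 *\<^sub>R axis 1 1 + w $ 2 *\<^sub>R axis 2 1" by (simp add: vec_eq_iff forall_2 axis_def)
  then show ?thesis unfolding coord_field_def
    using coord_vec_add[OF assms] coord_vec_scale[OF assms] by metis
qed

text \<open>A change of frame. \<open>ricci_chart\<close> uses it to convert components between two
  charts and to see that the two frame matrices are inverse to each other.\<close>

lemma components_expand:
  assumes "v \<in> tangent_space A p" "c \<in> A" "p \<in> chart_dom c"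
  shows "components d v $ k = (\<Sum>m\<in>UNIV. components c v $ m * components d (coord_field A c m p) $ k)"
proof -
  have "components d v $ k = components d (coord_vec A c p (components c v)) $ k"
    using tangent_rep[OF assms] by simp
  then show ?thesis unfolding coord_vec_expand[OF assms(2,3)] by (simp add: sum_2)
qed

text \<open>Near each point \<open>X f\<close> is the sum of the components of \<open>X\<close>
  times the partial derivatives of \<open>f\<close>, all of which are smooth.\<close>

lemma smooth_field_apply:
  assumes W: "open W" and X: "smooth_field A W X" and f: "smooth_fun A W f"
  shows "smooth_fun A W (\<lambda>p. X p f)"
proof (rule smooth_fun_local)
  fix p assume p: "p \<in> W"
  obtain c where c: "c \<in> A" "p \<in> chart_dom c" by (rule ex_chart)
  let ?V = "W \<inter> chart_dom c"
  let ?F = "\<lambda>i y. frechet_derivative (\<lambda>x. f (chart_inv c x)) (at y) (axis i 1)"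
  have V: "open ?V" using W open_dom[OF c(1)] by blast
  have "smooth_fun A ?V (\<lambda>q. ?F i (chart_map c q))" for i
  proof (rule smooth_fun_chart[OF c(1) V])
    have "smooth_on (im c ?V) (?F i)"
      using smooth_on_frechet[OF smooth_funD[OF f c(1)]] by (rule smooth_on_subset) auto
    then show "smooth_on (im c ?V) (\<lambda>x. ?F i (chart_map c (chart_inv c x)))"
      by (rule smooth_on_cong[OF open_im[OF c(1) V], rotated]) (use c in auto)
  qed auto
  then have sm: "smooth_fun A ?V (\<lambda>q. \<Sum>i\<in>UNIV. components c (X q) $ i * ?F i (chart_map c q))"
    by (intro smooth_fun_sum[OF V] smooth_fun_mult[OF V] smooth_field_components[OF W X c(1)])
  have eq: "(\<Sum>i\<in>UNIV. components c (X q) $ i * ?F i (chart_map c q)) = X q f" if "q \<in> ?V" for q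
  proof -
    have fq: "smooth_at A q f" using smooth_atI W f that by blast
    have "X q f = coord_vec A c q (components c (X q)) f"
      using tangent_rep[OF smooth_field_tangent[OF X] c(1)] that by simp
    also have "\<dots> = frechet_derivative (\<lambda>x. f (chart_inv c x)) (at (chart_map c q)) (components c (X q))"
      by (rule coord_vec_apply[OF fq])
    also have "\<dots> = (\<Sum>i\<in>UNIV. components c (X q) $ i *\<^sub>R ?F i (chart_map c q))"
      by (rule linear_axis_expansion[OF linear_coord_frechet[OF fq c(1)]]) (use that in blast)
    finally show ?thesis by simp
  qed
  have "smooth_fun A ?V (\<lambda>p. X p f)" by (rule smooth_fun_cong[OF V eq sm])
  then show "\<exists>V. open V \<and> p \<in> V \<and> smooth_fun A V (\<lambda>p. X p f)" using p c V by blast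
qed

lemma smooth_at_field_apply:
  assumes "open W" "p \<in> W" "smooth_field A W X" "smooth_at A p f"
  shows "smooth_at A p (\<lambda>q. X q f)"
proof -
  obtain V where V: "open V" "p \<in> V" "smooth_fun A V f" using assms unfolding smooth_at_def by blast
  have "smooth_fun A (V \<inter> W) (\<lambda>q. X q f)"
    by (rule smooth_field_apply[OF _ smooth_field_subset[OF assms(3)] smooth_fun_subset[OF V(3)]])
      (use V assms in auto)
  then show ?thesis using smooth_atI[of "V \<inter> W"] V assms by blast
qed

section \<open>The Lie bracket\<close>

lemma lie_bracket_apply:
  "smooth_at A p f \<Longrightarrow> lie_bracket A X Y p f = X p (\<lambda>q. Y q f) - Y p (\<lambda>q. X q f)"
  by (simp only: lie_bracket_def if_True)

lemma lie_bracket_nonsmooth: "\<not> smooth_at A p f \<Longrightarrow> lie_bracket A X Y p f = 0"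
  by (simp only: lie_bracket_def if_False)

lemma lie_bracket_antisym: "lie_bracket A Y X p = vscale (-1) (lie_bracket A X Y p)"
proof
  fix f
  show "lie_bracket A Y X p f = vscale (-1) (lie_bracket A X Y p) f"
    by (cases "smooth_at A p f") (simp_all add: lie_bracket_apply lie_bracket_nonsmooth vscale_def)
qed

lemma lie_bracket_add:
  assumes W: "open W" "p \<in> W" and X: "smooth_field A W X" and Y: "smooth_field A W Y" and Z: "smooth_field A W Z"
  shows "lie_bracket A (X + Y) Z p = lie_bracket A X Z p + lie_bracket A Y Z p"
proof
  fix f
  show "lie_bracket A (X + Y) Z p f = (lie_bracket A X Z p + lie_bracket A Y Z p) f"
    using tvec_add[OF smooth_field_tangent[OF Z W(2)] smooth_at_field_apply[OF W X] smooth_at_field_apply[OF W Y]]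
    by (cases "smooth_at A p f") (simp_all add: lie_bracket_apply lie_bracket_nonsmooth)
qed

text \<open>The extra term is the product rule for \<open>Y\<close> applied to
  \<open>g * X f\<close>. On functions not smooth at \<open>p\<close> the brackets are 0 by
  definition, and the extra term is 0 because \<open>X p\<close> is a tangent vector.\<close>

lemma lie_bracket_scale:
  assumes W: "open W" "p \<in> W" and X: "smooth_field A W X" and Y: "smooth_field A W Y" and g: "smooth_fun A W g"
  shows "lie_bracket A (field_scale g X) Y p = vscale (g p) (lie_bracket A X Y p) - vscale (Y p g) (X p)"
proof
  fix f
  show "lie_bracket A (field_scale g X) Y p f = (vscale (g p) (lie_bracket A X Y p) - vscale (Y p g) (X p)) f"
    using tvec_mult[OF smooth_field_tangent[OF Y W(2)] smooth_atI[OF W g] smooth_at_field_apply[OF W X]]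
      tvec_nonsmooth[OF smooth_field_tangent[OF X W(2)]]
    by (cases "smooth_at A p f")
      (simp_all add: lie_bracket_apply lie_bracket_nonsmooth field_scale_def vscale_def algebra_simps)
qed

text \<open>Components are the values on the coordinate functions; a coordinate field sends these to
  constants on the chart, which the other field annihilates.\<close>

lemma components_lie_bracket_coord:
  assumes c: "c \<in> A" "p \<in> chart_dom c"
  shows "components c (lie_bracket A (coord_field A c i) (coord_field A c j) p) = 0"
proof -
  have *: "coord_field A c i p (\<lambda>q. coord_field A c j q (\<lambda>q. chart_map c q $ k)) = 0" for i j k
  proof -
    have t: "coord_field A c i p \<in> tangent_space A p"
      unfolding coord_field_def using c by (rule coord_vec_tangent)
    have "coord_field A c j q (\<lambda>q. chart_map c q $ k) = axis j 1 $ k" if "q \<in> chart_dom c" for q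
      using components_coord_field[OF c(1) that, of j] by (simp add: components_def vec_eq_iff)
    then have "coord_field A c i p (\<lambda>q. coord_field A c j q (\<lambda>q. chart_map c q $ k)) =
        coord_field A c i p (\<lambda>q. axis j 1 $ k)"
      by (rule tvec_local[OF t open_dom[OF c(1)] c(2)])
    then show ?thesis using tvec_const[OF t] by simp
  qed
  show ?thesis using smooth_at_coord[OF c] by (simp add: components_def lie_bracket_apply vec_eq_iff *)
qed

section \<open>Tensorial functionals\<close>

text \<open>Linearity over functions at one point, for fields smooth on some neighbourhood of it.
  The lemmas below derive from this that \<open>T X\<close> depends only on \<open>X p\<close>, as
  for a covector.\<close>

definition tensorial :: "'a \<Rightarrow> ('a vfield \<Rightarrow> real) \<Rightarrow> bool" where
  "tensorial p T \<longleftrightarrow>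
    (\<forall>W X Y. open W \<longrightarrow> p \<in> W \<longrightarrow> smooth_field A W X \<longrightarrow> smooth_field A W Y \<longrightarrow> T (X + Y) = T X + T Y) \<and>
    (\<forall>W f X. open W \<longrightarrow> p \<in> W \<longrightarrow> smooth_field A W X \<longrightarrow> smooth_fun A W f \<longrightarrow>
      T (field_scale f X) = f p * T X)"

lemma tensorial_add:
  "tensorial p T \<Longrightarrow> open W \<Longrightarrow> p \<in> W \<Longrightarrow> smooth_field A W X \<Longrightarrow> smooth_field A W Y \<Longrightarrow> T (X + Y) = T X + T Y"
  unfolding tensorial_def by blast

lemma tensorial_scale:
  "tensorial p T \<Longrightarrow> open W \<Longrightarrow> p \<in> W \<Longrightarrow> smooth_field A W X \<Longrightarrow> smooth_fun A W f \<Longrightarrow>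
    T (field_scale f X) = f p * T X"
  unfolding tensorial_def by blast

text \<open>A field vanishing on \<open>W\<close> is unchanged by multiplication with the indicator function of the
  complement of \<open>W\<close>, which is smooth on \<open>W\<close>; this gives locality without bump functions.\<close>

lemma vanishing_field:
  assumes "open W" "\<And>q. q \<in> W \<Longrightarrow> Z q = 0"
  shows "field_scale (indicator (- W)) Z = Z" "smooth_fun A W (indicator (- W))"
proof -
  show "field_scale (indicator (- W)) Z = Z"
    using assms by (auto simp: field_scale_def fun_eq_iff vscale_def indicator_def)
  show "smooth_fun A W (indicator (- W))"
    by (rule smooth_fun_cong[OF assms(1) _ smooth_fun_const[of _ 0]]) auto
qed

lemma tensorial_cong:
  assumes T: "tensorial p T" and W: "open W" "p \<in> W"
    and X: "smooth_field A W X" "smooth_field A W Y" and eq: "\<And>q. q \<in> W \<Longrightarrow> X q = Y q"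
  shows "T X = T Y"
proof -
  have Z: "smooth_field A W (X - Y)" using smooth_field_diff W X by blast
  note v = vanishing_field[OF W(1), of "X - Y"]
  have "T (X - Y) = T (field_scale (indicator (- W)) (X - Y))" using v(1) eq by simp
  also have "\<dots> = 0" using T W Z v(2) eq unfolding tensorial_def by (simp add: indicator_def)
  finally have "T (Y + (X - Y)) = T Y" using T W Z X unfolding tensorial_def by (metis add.right_neutral)
  then show ?thesis by simp
qed

text \<open>On the common domain \<open>X\<close> equals the combination of coordinate fields with
  its component functions as coefficients. \<open>tensorial_cong\<close> ignores what happens
  elsewhere, and linearity over functions evaluates the coefficients at \<open>p\<close>.\<close>

lemma tensorial_expand:
  assumes T: "tensorial p T" and W: "open W" "p \<in> W" and X: "smooth_field A W X"
    and c: "c \<in> A" "p \<in> chart_dom c"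
  shows "T X = (\<Sum>i\<in>UNIV. components c (X p) $ i * T (coord_field A c i))"
proof -
  let ?V = "W \<inter> chart_dom c"
  let ?S = "\<lambda>i. field_scale (\<lambda>q. components c (X q) $ i) (coord_field A c i)"
  have V: "open ?V" "p \<in> ?V" using W c open_dom[OF c(1)] by auto
  have S: "smooth_field A ?V (?S i)" for i
    using c by (intro smooth_field_scale[OF V(1)] smooth_field_components[OF W(1) X] smooth_field_coord) auto
  have "T X = T (?S 1 + ?S 2)"
  proof (rule tensorial_cong[OF T V smooth_field_subset[OF X] smooth_field_add[OF V(1) S S]])
    fix q assume "q \<in> ?V"
    then show "X q = (?S 1 + ?S 2) q"
      using coord_vec_expand[OF c(1), of q "components c (X q)"] tangent_rep[OF smooth_field_tangent[OF X] c(1)]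
      by (simp add: field_scale_def)
  qed auto
  also have "\<dots> = T (?S 1) + T (?S 2)" using T V S unfolding tensorial_def by blast
  finally have "T X = T (?S 1) + T (?S 2)" .
  moreover have "T (?S i) = components c (X p) $ i * T (coord_field A c i)" for i
    by (rule tensorial_scale[OF T V smooth_field_coord smooth_field_components[OF W(1) X c(1)]])
      (use c in auto)
  ultimately show ?thesis by (simp add: sum_2)
qed

text \<open>Both sides have the same expansion in a common chart. The two fields may be smooth on
  different neighbourhoods, which permits replacing a field by any extension of its value at
  \<open>p\<close>.\<close>

lemma tensorial_point:
  assumes T: "tensorial p T" and W: "open W" "p \<in> W" and X: "smooth_field A W X"
    and V: "open V" "p \<in> V" and Y: "smooth_field A V Y" and "X p = Y p"
  shows "T X = T Y"
proof -
  obtain c where "c \<in> A" "p \<in> chart_dom c" by (rule ex_chart)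
  then show ?thesis using tensorial_expand[OF T W X] tensorial_expand[OF T V Y] assms by simp
qed

text \<open>Shrinking to subsets of \<open>W\<close> guarantees that the fields held fixed in the
  remaining slots are smooth wherever the axioms of the connection are applied.\<close>

lemma tensorialI:
  assumes W: "open W" "p \<in> W"
    and add: "\<And>V X Y. open V \<Longrightarrow> p \<in> V \<Longrightarrow> V \<subseteq> W \<Longrightarrow> smooth_field A V X \<Longrightarrow> smooth_field A V Y \<Longrightarrow>
      T (X + Y) = T X + T Y"
    and scale: "\<And>V X f. open V \<Longrightarrow> p \<in> V \<Longrightarrow> V \<subseteq> W \<Longrightarrow> smooth_field A V X \<Longrightarrow> smooth_fun A V f \<Longrightarrow>
      T (field_scale f X) = f p * T X"
  shows "tensorial p T"
  unfolding tensorial_def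
proof (intro conjI allI impI)
  fix V X Y assume "open V" "p \<in> V" "smooth_field A V X" "smooth_field A V Y"
  then show "T (X + Y) = T X + T Y"
    using add[of "V \<inter> W" X Y] W smooth_field_subset[of V _ "V \<inter> W"] by auto
next
  fix V f X assume "open V" "p \<in> V" "smooth_field A V X" "smooth_fun A V f"
  then show "T (field_scale f X) = f p * T X"
    using scale[of "V \<inter> W" X f] W smooth_field_subset[of V _ "V \<inter> W"] smooth_fun_subset[of V _ "V \<inter> W"]
    by auto
qed

lemma tensorial_sum:
  "(\<And>i. i \<in> I \<Longrightarrow> tensorial p (T i)) \<Longrightarrow> tensorial p (\<lambda>X. \<Sum>i\<in>I. T i X)"
  unfolding tensorial_def by (simp add: sum.distrib sum_distrib_left)

text \<open>Serves \<open>ricci\<close>, whose formula in a given chart is available only for fields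
  smooth near \<open>p\<close>; agreement on such fields is enough.\<close>

lemma tensorial_eq:
  assumes W: "open W" "p \<in> W" and T: "tensorial p T"
    and eq: "\<And>V X. open V \<Longrightarrow> p \<in> V \<Longrightarrow> V \<subseteq> W \<Longrightarrow> smooth_field A V X \<Longrightarrow> T' X = T X"
  shows "tensorial p T'"
proof (rule tensorialI[OF W])
  fix V X Y assume *: "open V" "p \<in> V" "V \<subseteq> W" "smooth_field A V X" "smooth_field A V Y"
  then show "T' (X + Y) = T' X + T' Y"
    using eq[OF *(1-3)] tensorial_add[OF T *(1,2,4,5)] smooth_field_add[OF *(1,4,5)] by simp
next
  fix V X f assume *: "open V" "p \<in> V" "V \<subseteq> W" "smooth_field A V X" "smooth_fun A V f"
  then show "T' (field_scale f X) = f p * T' X"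
    using eq[OF *(1-3)] tensorial_scale[OF T *(1,2,4,5)] smooth_field_scale[OF *(1,5,4)] by simp
qed

end

section \<open>Torsion-free connections\<close>

locale tf_connection = smooth_surface A for A :: "'a::{t2_space, second_countable_topology} chart set" +
  fixes D :: "'a covd"
  assumes connection: "is_connection A D" and torsion: "torsion_free A D"
begin

context
  fixes W :: "'a set"
  assumes W: "open W"
begin

lemmas connection_on = connection[unfolded is_connection_def, rule_format, OF W]

lemma D_smooth: "smooth_field A W X \<Longrightarrow> smooth_field A W Y \<Longrightarrow> smooth_field A W (D X Y)"
  by (rule connection_on[THEN conjunct1, rule_format])

lemma D_add_left: "smooth_field A W X \<Longrightarrow> smooth_field A W X' \<Longrightarrow> smooth_field A W Y \<Longrightarrow> p \<in> W \<Longrightarrow>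
    D (X + X') Y p = D X Y p + D X' Y p"
  by (rule connection_on[THEN conjunct2, THEN conjunct1, rule_format])

lemma D_scale_left: "smooth_fun A W f \<Longrightarrow> smooth_field A W X \<Longrightarrow> smooth_field A W Y \<Longrightarrow> p \<in> W \<Longrightarrow>
    D (field_scale f X) Y p = vscale (f p) (D X Y p)"
  by (rule connection_on[THEN conjunct2, THEN conjunct2, THEN conjunct1, rule_format])

lemma D_add_right: "smooth_field A W X \<Longrightarrow> smooth_field A W Y \<Longrightarrow> smooth_field A W Y' \<Longrightarrow> p \<in> W \<Longrightarrow>
    D X (Y + Y') p = D X Y p + D X Y' p"
  by (rule connection_on[THEN conjunct2, THEN conjunct2, THEN conjunct2, THEN conjunct1, rule_format])

lemma D_scale_right: "smooth_fun A W f \<Longrightarrow> smooth_field A W X \<Longrightarrow> smooth_field A W Y \<Longrightarrow> p \<in> W \<Longrightarrow>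
    D X (field_scale f Y) p = vscale (X p f) (Y p) + vscale (f p) (D X Y p)"
  by (rule connection_on[THEN conjunct2, THEN conjunct2, THEN conjunct2, THEN conjunct2, rule_format])

lemma torsion_eq: "smooth_field A W X \<Longrightarrow> smooth_field A W Y \<Longrightarrow> p \<in> W \<Longrightarrow>
    D X Y p - D Y X p = lie_bracket A X Y p"
  by (rule torsion[unfolded torsion_free_def, rule_format, OF W])

text \<open>The indicator argument of \<open>vanishing_field\<close>, applied to the left argument
  and then to the right one. On the right the Leibniz rule adds a term with the factor
  \<open>(Y - Y') p\<close>, which is zero.\<close>

lemma D_cong:
  assumes X: "smooth_field A W X" "smooth_field A W X'" and Y: "smooth_field A W Y" "smooth_field A W Y'"
    and eq: "\<And>q. q \<in> W \<Longrightarrow> X q = X' q" "\<And>q. q \<in> W \<Longrightarrow> Y q = Y' q" and p: "p \<in> W"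
  shows "D X Y p = D X' Y' p"
proof -
  have Z: "smooth_field A W (X - X')" "smooth_field A W (Y - Y')"
    using smooth_field_diff[OF W] X Y by auto
  have "D (X - X') Y p = D (field_scale (indicator (- W)) (X - X')) Y p"
    using vanishing_field(1)[OF W, of "X - X'"] eq by simp
  also have "\<dots> = 0"
    using D_scale_left[OF vanishing_field(2)[OF W, of "X - X'"] Z(1) Y(1) p] eq p by (simp add: vscale_simps)
  finally have 1: "D X Y p = D X' Y p"
    using D_add_left[OF X(2) Z(1) Y(1) p] by simp
  have "D X' (Y - Y') p = D X' (field_scale (indicator (- W)) (Y - Y')) p"
    using vanishing_field(1)[OF W, of "Y - Y'"] eq by simp
  also have "\<dots> = 0"
    using D_scale_right[OF vanishing_field(2)[OF W, of "Y - Y'"] X(2) Z(2) p] eq p by (simp add: vscale_simps)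
  finally show ?thesis
    using D_add_right[OF X(2) Y(2) Z(2) p] 1 by simp
qed

lemma D_diff_left:
  assumes "smooth_field A W X" "smooth_field A W X'" "smooth_field A W Y" "p \<in> W"
  shows "D (X - X') Y p = D X Y p - D X' Y p"
  unfolding diff_field[of X X']
  using D_add_left[OF assms(1) smooth_field_scale[OF W smooth_fun_const assms(2)] assms(3,4), of "-1"]
    D_scale_left[OF smooth_fun_const assms(2,3,4), of "-1"]
  by (simp add: vscale_simps)

text \<open>Torsion-freeness makes the bracket of smooth fields a smooth field, without appeal to the
  symmetry of second derivatives.\<close>

lemma smooth_lie_bracket:
  assumes "smooth_field A W X" "smooth_field A W Y"
  shows "smooth_field A W (lie_bracket A X Y)"
  by (rule smooth_field_cong[OF W _ smooth_field_diff[OF W D_smooth[OF assms] D_smooth[OF assms(2,1)]]])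
    (simp add: torsion_eq assms)

lemma smooth_curvature:
  assumes "smooth_field A W X" "smooth_field A W Y" "smooth_field A W Z"
  shows "smooth_field A W (curvature A D X Y Z)"
  unfolding curvature_def using assms
  by (intro smooth_field_diff[OF W] D_smooth smooth_lie_bracket)

lemma curvature_antisym:
  assumes "smooth_field A W X" "smooth_field A W Y" "smooth_field A W Z" "p \<in> W"
  shows "curvature A D Y X Z p = vscale (-1) (curvature A D X Y Z p)"
proof -
  have "lie_bracket A Y X = field_scale (\<lambda>q. -1) (lie_bracket A X Y)"
    by (rule ext) (simp only: field_scale_def lie_bracket_antisym[of Y X])
  then have "D (lie_bracket A Y X) Z p = vscale (-1) (D (lie_bracket A X Y) Z p)"
    using D_scale_left[OF smooth_fun_const smooth_lie_bracket[OF assms(1,2)] assms(3,4)] by simp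
  then show ?thesis by (simp add: curvature_def vscale_def fun_eq_iff)
qed

lemma curvature_add_left:
  assumes "smooth_field A W X" "smooth_field A W X'" "smooth_field A W Y" "smooth_field A W Z" "p \<in> W"
  shows "curvature A D (X + X') Y Z p = curvature A D X Y Z p + curvature A D X' Y Z p"
proof -
  note s = assms smooth_field_add[OF W] D_smooth smooth_lie_bracket
  have "D Y (D (X + X') Z) p = D Y (D X Z + D X' Z) p"
    by (rule D_cong) (auto simp: D_add_left s)
  moreover have "D (lie_bracket A (X + X') Y) Z p = D (lie_bracket A X Y + lie_bracket A X' Y) Z p"
    by (rule D_cong) (auto simp: lie_bracket_add[OF W] s)
  ultimately show ?thesis by (simp add: curvature_def D_add_left D_add_right s)
qed

text \<open>Differentiating \<open>f\<close> in \<open>D Y (f D X Z)\<close> produces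
  \<open>(Y f) D X Z\<close>; the bracket \<open>[f X, Y] = f [X, Y] - (Y f) X\<close> produces the
  same term with the sign that cancels it.\<close>

lemma curvature_scale_left:
  assumes "smooth_field A W X" "smooth_field A W Y" "smooth_field A W Z" "smooth_fun A W f" "p \<in> W"
  shows "curvature A D (field_scale f X) Y Z p = vscale (f p) (curvature A D X Y Z p)"
proof -
  note s = assms smooth_field_add[OF W] smooth_field_diff[OF W] smooth_field_scale[OF W] D_smooth
    smooth_lie_bracket smooth_field_apply[OF W]
  have "D Y (D (field_scale f X) Z) p = D Y (field_scale f (D X Z)) p"
    by (rule D_cong) (auto simp: D_scale_left s field_scale_apply)
  moreover have "D (lie_bracket A (field_scale f X) Y) Z p
      = D (field_scale f (lie_bracket A X Y) - field_scale (\<lambda>q. Y q f) X) Z p"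
    by (rule D_cong) (auto simp: lie_bracket_scale[OF W] s field_scale_apply)
  ultimately show ?thesis
    by (simp add: curvature_def D_scale_left D_diff_left D_scale_right s vscale_simps)
qed

lemma curvature_add_right:
  assumes "smooth_field A W X" "smooth_field A W Y" "smooth_field A W Z" "smooth_field A W Z'" "p \<in> W"
  shows "curvature A D X Y (Z + Z') p = curvature A D X Y Z p + curvature A D X Y Z' p"
proof -
  note s = assms smooth_field_add[OF W] D_smooth smooth_lie_bracket
  have "D X (D Y (Z + Z')) p = D X (D Y Z + D Y Z') p" "D Y (D X (Z + Z')) p = D Y (D X Z + D X Z') p"
    by (rule D_cong; auto simp: D_add_right s)+
  then show ?thesis by (simp add: curvature_def D_add_left D_add_right s)
qed

text \<open>The terms with one derivative of \<open>f\<close> are symmetric in \<open>X\<close> and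
  \<open>Y\<close> and cancel; those with two combine to
  \<open>X (Y f) - Y (X f) - [X, Y] f = 0\<close>.\<close>

lemma curvature_scale_right:
  assumes "smooth_field A W X" "smooth_field A W Y" "smooth_field A W Z" "smooth_fun A W f" "p \<in> W"
  shows "curvature A D X Y (field_scale f Z) p = vscale (f p) (curvature A D X Y Z p)"
proof -
  note s = assms smooth_field_add[OF W] smooth_field_diff[OF W] smooth_field_scale[OF W] D_smooth
    smooth_lie_bracket smooth_field_apply[OF W]
  have "D U (D V (field_scale f Z)) p = D U (field_scale (\<lambda>q. V q f) Z + field_scale f (D V Z)) p"
    if "smooth_field A W U" "smooth_field A W V" for U V
    by (rule D_cong) (auto simp: D_scale_right s that field_scale_apply)
  then have "D U (D V (field_scale f Z)) p = vscale (U p (\<lambda>q. V q f)) (Z p) + vscale (V p f) (D U Z p)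
      + vscale (U p f) (D V Z p) + vscale (f p) (D U (D V Z) p)"
    if "smooth_field A W U" "smooth_field A W V" for U V
    by (simp add: D_add_right D_scale_right s that add.assoc)
  then show ?thesis
    by (simp add: curvature_def D_scale_right s lie_bracket_apply[OF smooth_atI[OF W assms(5,4)]])
      (simp add: vscale_def fun_eq_iff algebra_simps)
qed

end

lemma tensorial_curvature:
  assumes W: "open W" "p \<in> W" and X: "smooth_field A W X" and Y: "smooth_field A W Y"
  shows "tensorial p (\<lambda>Z. components c (curvature A D Z X Y p) $ k)"
    and "tensorial p (\<lambda>Z. components c (curvature A D X Z Y p) $ k)"
    and "tensorial p (\<lambda>Z. components c (curvature A D X Y Z p) $ k)"
proof -
  note s = smooth_field_subset[OF X] smooth_field_subset[OF Y]
  show "tensorial p (\<lambda>Z. components c (curvature A D Z X Y p) $ k)"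
    by (rule tensorialI[OF W]) (simp_all add: curvature_add_left s curvature_scale_left)
  \<comment> \<open>The second slot is reduced to the first by antisymmetry.\<close>
  show "tensorial p (\<lambda>Z. components c (curvature A D X Z Y p) $ k)"
  proof (rule tensorialI[OF W])
    fix V U U' assume V: "open V" "p \<in> V" "V \<subseteq> W" and U: "smooth_field A V U" "smooth_field A V U'"
    show "components c (curvature A D X (U + U') Y p) $ k
        = components c (curvature A D X U Y p) $ k + components c (curvature A D X U' Y p) $ k"
      using curvature_antisym[OF V(1) U(1) s(1,2)[OF V(3)] V(2)]
        curvature_antisym[OF V(1) U(2) s(1,2)[OF V(3)] V(2)]
        curvature_antisym[OF V(1) smooth_field_add[OF V(1) U] s(1,2)[OF V(3)] V(2)]
        curvature_add_left[OF V(1) U s(1,2)[OF V(3)] V(2)] by simp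
  next
    fix V U f assume V: "open V" "p \<in> V" "V \<subseteq> W" and U: "smooth_field A V U" "smooth_fun A V f"
    show "components c (curvature A D X (field_scale f U) Y p) $ k
        = f p * components c (curvature A D X U Y p) $ k"
      using curvature_antisym[OF V(1) U(1) s(1,2)[OF V(3)] V(2)]
        curvature_antisym[OF V(1) smooth_field_scale[OF V(1) U(2,1)] s(1,2)[OF V(3)] V(2)]
        curvature_scale_left[OF V(1) U(1) s(1,2)[OF V(3)] U(2) V(2)] by simp
  qed
  show "tensorial p (\<lambda>Z. components c (curvature A D X Y Z p) $ k)"
    by (rule tensorialI[OF W]) (simp_all add: curvature_add_right s curvature_scale_right)
qed

section \<open>The Ricci tensor\<close>

text \<open>A trace does not depend on the frame. This frees \<open>ricci\<close> from the arbitrary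
  chart \<open>chart_at A p\<close> in its definition.\<close>

lemma ricci_chart:
  assumes W: "open W" "p \<in> W" and X: "smooth_field A W X" and Y: "smooth_field A W Y"
    and c: "c \<in> A" "p \<in> chart_dom c"
  shows "ricci A D X Y p = (\<Sum>k\<in>UNIV. components c (curvature A D (coord_field A c k) X Y p) $ k)"
proof -
  define d where "d = chart_at A p"
  have d: "d \<in> A" "p \<in> chart_dom d" using chart_at unfolding d_def by auto
  define t where "t m l = components c (curvature A D (coord_field A c l) X Y p) $ m" for m l
  define a where "a m k = components d (coord_field A c m p) $ k" for m k
  define b where "b k l = components c (coord_field A d k p) $ l" for k l
  have V: "open (W \<inter> chart_dom d)" "p \<in> W \<inter> chart_dom d" using W d open_dom[OF d(1)] by auto
  have dV: "smooth_field A (W \<inter> chart_dom d) (coord_field A d k)" for k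
    using smooth_field_coord[OF d(1)] by blast
  have "curvature A D (coord_field A d k) X Y p \<in> tangent_space A p" for k
    using smooth_curvature[OF V(1) dV smooth_field_subset[OF X] smooth_field_subset[OF Y]] V(2)
    by (intro smooth_field_tangent) auto
  then have "components d (curvature A D (coord_field A d k) X Y p) $ k
     = (\<Sum>m\<in>UNIV. components c (curvature A D (coord_field A d k) X Y p) $ m * a m k)" for k
    unfolding a_def by (rule components_expand[OF _ c])
  moreover have "components c (curvature A D (coord_field A d k) X Y p) $ m = (\<Sum>l\<in>UNIV. b k l * t m l)" for k m
    unfolding b_def t_def by (rule tensorial_expand[OF tensorial_curvature(1)[OF W X Y] V dV c])
  ultimately have e: "ricci A D X Y p = (\<Sum>k\<in>UNIV. \<Sum>m\<in>UNIV. (\<Sum>l\<in>UNIV. b k l * t m l) * a m k)"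
    by (simp add: ricci_def d_def[symmetric])
  \<comment> \<open>Expanding a coordinate vector of \<open>c\<close> in the frame of
    \<open>d\<close> and reading it again in \<open>c\<close> shows that the matrices
    \<open>a\<close> and \<open>b\<close> are inverse.\<close>
  have "coord_field A c m p \<in> tangent_space A p" for m
    unfolding coord_field_def using c by (rule coord_vec_tangent)
  from components_expand[OF this d, of c _ l for l]
  have ab: "(\<Sum>k\<in>UNIV. a m k * b k l) = axis m 1 $ l" for m l
    using c by (simp add: a_def b_def)
  have ab: "a m 1 * b 1 l + a m 2 * b 2 l = (if l = m then 1 else 0)" for m l
    using ab[of m l] by (simp add: sum_2 axis_def)
  have "ricci A D X Y p = (a 1 1 * b 1 1 + a 1 2 * b 2 1) * t 1 1 + (a 1 1 * b 1 2 + a 1 2 * b 2 2) * t 1 2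
     + (a 2 1 * b 1 1 + a 2 2 * b 2 1) * t 2 1 + (a 2 1 * b 1 2 + a 2 2 * b 2 2) * t 2 2"
    unfolding e sum_2 by (simp add: algebra_simps)
  then show ?thesis unfolding ab by (simp add: sum_2 t_def)
qed

lemma tensorial_ricci:
  assumes W: "open W" "p \<in> W" and Y: "smooth_field A W Y"
  shows "tensorial p (\<lambda>X. ricci A D X Y p)" and "tensorial p (\<lambda>X. ricci A D Y X p)"
proof -
  obtain c where c: "c \<in> A" "p \<in> chart_dom c" by (rule ex_chart)
  let ?V = "W \<inter> chart_dom c"
  have V: "open ?V" "p \<in> ?V" using W c open_dom[OF c(1)] by auto
  have s: "smooth_field A ?V (coord_field A c k)" "smooth_field A ?V Y" for k
    using smooth_field_coord[OF c(1)] smooth_field_subset[OF Y] by auto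
  show "tensorial p (\<lambda>X. ricci A D X Y p)"
    by (rule tensorial_eq[OF V tensorial_sum[OF tensorial_curvature(2)[OF V s]]])
      (use ricci_chart[OF _ _ _ smooth_field_subset[OF Y] c] in auto)
  show "tensorial p (\<lambda>X. ricci A D Y X p)"
    by (rule tensorial_eq[OF V tensorial_sum[OF tensorial_curvature(3)[OF V s]]])
      (use ricci_chart[OF _ _ smooth_field_subset[OF Y] _ c] in auto)
qed

text \<open>The chart \<open>chart_at A p\<close> jumps uncontrollably with \<open>p\<close>, so the
  definition itself shows no smoothness; \<open>ricci_chart\<close> replaces it by one chart on a
  whole neighbourhood.\<close>

lemma smooth_ricci:
  assumes W: "open W" and X: "smooth_field A W X" and Y: "smooth_field A W Y"
  shows "smooth_fun A W (\<lambda>p. ricci A D X Y p)"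
proof (rule smooth_fun_local)
  fix p assume p: "p \<in> W"
  obtain c where c: "c \<in> A" "p \<in> chart_dom c" by (rule ex_chart)
  let ?V = "W \<inter> chart_dom c"
  have V: "open ?V" "p \<in> ?V" using p W c open_dom[OF c(1)] by auto
  have s: "smooth_field A ?V (coord_field A c k)" "smooth_field A ?V X" "smooth_field A ?V Y" for k
    using smooth_field_coord[OF c(1)] smooth_field_subset[OF X] smooth_field_subset[OF Y] by auto
  have "smooth_fun A ?V (\<lambda>p. components c (curvature A D (coord_field A c k) X Y p) $ k)" for k
    using smooth_field_components[OF V(1) smooth_curvature[OF V(1) s] c(1)]
    by (rule smooth_fun_subset) auto
  then have sm: "smooth_fun A ?V (\<lambda>p. \<Sum>k\<in>UNIV. components c (curvature A D (coord_field A c k) X Y p) $ k)"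
    by (intro smooth_fun_sum[OF V(1)])
  have "smooth_fun A ?V (\<lambda>p. ricci A D X Y p)"
    by (rule smooth_fun_cong[OF V(1) _ sm]) (rule ricci_chart[symmetric, OF V(1) _ s(2,3) c(1)], auto)
  then show "\<exists>V. open V \<and> p \<in> V \<and> smooth_fun A V (\<lambda>p. ricci A D X Y p)" using V by blast
qed

end

section \<open>Second fundamental form of the zero section\<close>

text \<open>Nondegeneracy makes \<open>u \<mapsto> b u\<close> injective, hence surjective onto the
  dual by finite dimension. The map \<open>F\<close> encodes functionals as vectors by their values
  on the basis.\<close>

lemma bilinear_represent:
  fixes b :: "'e::euclidean_space \<Rightarrow> 'e \<Rightarrow> real"
  assumes b: "bilinear b" and nondeg: "\<And>u. (\<And>v. b u v = 0) \<Longrightarrow> u = 0" and L: "linear L"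
  shows "\<exists>!u. \<forall>v. b u v = L v"
proof (rule ex_ex1I)
  define F where "F u = (\<Sum>e\<in>Basis. b u e *\<^sub>R e)" for u
  have lin: "linear (b u)" for u using b unfolding bilinear_def by blast
  have "linear F" unfolding F_def
    by (rule linearI) (simp_all add: bilinear_ladd[OF b] bilinear_lmul[OF b] scaleR_add_left sum.distrib scaleR_sum_right)
  moreover have F: "F u \<bullet> e = b u e" if "e \<in> Basis" for u e
    using that by (simp add: F_def)
  have "inj F"
  proof (subst linear_injective_0[OF \<open>linear F\<close>], intro allI impI)
    fix u assume "F u = 0"
    then have "b u e = 0" if "e \<in> Basis" for e using F[OF that, of u] by simp
    then have "b u = (\<lambda>v. 0)" using lin by (intro linear_eq_stdbasis) (auto simp: linear_zero)
    then show "u = 0" using nondeg by metis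
  qed
  ultimately have "surj F" by (rule linear_injective_imp_surjective) (rule refl)
  then obtain u where u: "F u = (\<Sum>e\<in>Basis. L e *\<^sub>R e)" by (metis surjD)
  have "b u e = L e" if "e \<in> Basis" for e using F[OF that, of u] that unfolding u by simp
  then have "b u = L" using lin L by (intro linear_eq_stdbasis)
  then show "\<exists>u. \<forall>v. b u v = L v" by auto
next
  fix u u' assume "\<forall>v. b u v = L v" "\<forall>v. b u' v = L v"
  then have "b (u - u') v = 0" for v by (simp add: bilinear_lsub[OF b])
  then show "u = u'" using nondeg[of "u - u'"] by simp
qed

text \<open>\<open>lc_christoffel\<close> is a definite description, so the formula is available
  only once existence and uniqueness are shown. Here \<open>K\<close> is the Koszul expression,
  \<open>dh\<close> the derivative of \<open>h\<close> at \<open>z\<close>, and \<open>G\<close> the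
  vector representing \<open>K\<close> under \<open>h z\<close>.\<close>

lemma lc_christoffel_koszul:
  fixes h :: "'e::euclidean_space \<Rightarrow> 'e \<Rightarrow> 'e \<Rightarrow> real"
  assumes b: "bilinear (h z)" and sym: "\<And>u v. h z u v = h z v u"
    and nondeg: "\<And>u. (\<And>v. h z u v = 0) \<Longrightarrow> u = 0"
    and der: "\<And>u v. ((\<lambda>y. h y u v) has_derivative (\<lambda>t. dh t u v)) (at z)"
    and db: "\<And>t. bilinear (dh t)" and dsym: "\<And>t u v. dh t u v = dh t v u"
  shows "h z (lc_christoffel h z u v) w = (dh u v w + dh v u w - dh w u v) / 2"
proof -
  define K where "K u v w = (dh u v w + dh v u w - dh w u v) / 2" for u v w
  have fr: "frechet_derivative (\<lambda>y. h y u v) (at z) = (\<lambda>t. dh t u v)" for u v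
    by (rule frechet_derivative_eq[OF der])
  have ld: "linear (\<lambda>t. dh t u v)" for u v using has_derivative_linear[OF der] .
  note lin = linear_add[OF ld] linear_cmul[OF ld] bilinear_ladd[OF db] bilinear_radd[OF db]
    bilinear_lmul[OF db] bilinear_rmul[OF db]
  have "linear (K u v)" for u v
    by (rule linearI) (simp_all add: K_def lin algebra_simps add_divide_distrib diff_divide_distrib)
  then have ex: "\<exists>!x. \<forall>w. h z x w = K u v w" for u v
    using bilinear_represent[OF b nondeg] by blast
  define G where "G u v = (THE x. \<forall>w. h z x w = K u v w)" for u v
  have G: "h z (G u v) w = K u v w" for u v w
    using theI'[OF ex, of u v] unfolding G_def by blast
  have G_eq: "x = G u v" if "\<And>w. h z x w = K u v w" for x u v
    using ex[of u v] that G by blast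
  \<comment> \<open>The metric condition in its three cyclic arrangements, added with signs +, +, -
    and simplified by the symmetry of \<open>F\<close>, leaves
    \<open>2 * h z (F u v) w\<close>.\<close>
  have unique: "F = G" if bF: "bilinear F" and sF: "\<forall>u v. F u v = F v u"
    and mF: "\<forall>t u v. dh t u v = h z (F t u) v + h z u (F t v)" for F
  proof (intro ext G_eq)
    fix u v w
    show "h z (F u v) w = K u v w"
      using mF[rule_format, of u v w] mF[rule_format, of v u w] mF[rule_format, of w u v]
        sF[rule_format, of u v] sF[rule_format, of u w] sF[rule_format, of v w]
        sym[of v "F u w"] sym[of u "F v w"]
      by (simp add: K_def)
  qed
  have bG: "bilinear G"
    unfolding bilinear_def
  proof (intro conjI allI linearI)
    show "G x (y + y') = G x y + G x y'" for x y y'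
      by (rule G_eq[symmetric]) (simp add: bilinear_ladd[OF b] G K_def lin field_simps)
    show "G x (r *\<^sub>R y) = r *\<^sub>R G x y" for x y r
      by (rule G_eq[symmetric]) (simp add: bilinear_lmul[OF b] G K_def lin field_simps)
    show "G (x + x') y = G x y + G x' y" for x x' y
      by (rule G_eq[symmetric]) (simp add: bilinear_ladd[OF b] G K_def lin field_simps)
    show "G (r *\<^sub>R x) y = r *\<^sub>R G x y" for x y r
      by (rule G_eq[symmetric]) (simp add: bilinear_lmul[OF b] G K_def lin field_simps)
  qed
  have sG: "G u v = G v u" for u v
    by (rule G_eq) (simp add: G K_def dsym[of _ u v])
  have mG: "dh t u v = h z (G t u) v + h z u (G t v)" for t u v
    by (simp add: G sym[of u] K_def dsym[of t v u] dsym[of u t v] dsym[of v t u] field_simps)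
  have "lc_christoffel h z = G"
    unfolding lc_christoffel_def fr by (rule the_equality) (use bG sG mG unique in blast)+
  then show ?thesis using G by (simp add: K_def)
qed

text \<open>A vanishing normal component makes the vector equal to its tangential part, which has
  the form \<open>(a, 0)\<close>. Nondegeneracy on the subspace is what makes the tangential part
  exist uniquely, so that the description in \<open>normal_component\<close> denotes it.\<close>

lemma zero_normal_component:
  fixes b :: "'d::euclidean_space \<times> 'd \<Rightarrow> 'd \<times> 'd \<Rightarrow> real"
  assumes b: "bilinear b" and nondeg: "\<And>a. (\<And>c. b (a, 0) (c, 0) = 0) \<Longrightarrow> a = 0"
    and zero: "normal_component b (range (\<lambda>a. (a, 0))) w = 0"
  shows "snd w = 0"
proof -
  have bT: "bilinear (\<lambda>a c. b (a, 0) (c, 0))"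
    using b bilinear_ladd[OF b, of "(x, 0)" "(y, 0)" for x y] bilinear_radd[OF b, of _ "(x, 0)" "(y, 0)" for x y]
      bilinear_lmul[OF b, of _ "(x, 0)" for x] bilinear_rmul[OF b, of _ _ "(x, 0)" for x]
    unfolding bilinear_def by (auto intro!: linearI)
  have L: "linear (\<lambda>c. b w (c, 0))"
    using bilinear_radd[OF b, of w "(x, 0)" "(y, 0)" for x y] bilinear_rmul[OF b, of w _ "(x, 0)" for x]
    by (intro linearI) simp_all
  have "\<exists>!a. \<forall>c. b (a, 0) (c, 0) = b w (c, 0)"
    by (rule bilinear_represent[OF bT nondeg L])
  then obtain a where a: "\<And>c. b (a, 0) (c, 0) = b w (c, 0)"
    and u: "\<And>a'. (\<And>c. b (a', 0) (c, 0) = b w (c, 0)) \<Longrightarrow> a' = a" by blast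
  have "(THE t. t \<in> range (\<lambda>a. (a, 0)) \<and> (\<forall>u\<in>range (\<lambda>a. (a, 0)). b (w - t) u = 0)) = (a, 0)"
    by (rule the_equality) (auto simp: bilinear_lsub[OF b] a intro!: u)
  then show ?thesis using zero unfolding normal_component_def by simp
qed

text \<open>The computation in one chart, detached from the surface: \<open>G\<close> stands for the
  Christoffel map and \<open>S\<close> for the Schouten form.\<close>

lemma zero_section_second_fundamental_form:
  fixes G :: "real^2 \<Rightarrow> real^2 \<Rightarrow> real^2 \<Rightarrow> real^2" and S :: "real^2 \<Rightarrow> real^2 \<Rightarrow> real^2 \<Rightarrow> real"
  assumes V: "open V" "x \<in> V"
    and h: "\<And>y \<xi> s t. y \<in> V \<Longrightarrow> h (y, \<xi>) s t = (snd s \<bullet> fst t + snd t \<bullet> fst s) / 2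
      - \<xi> \<bullet> G y (fst s) (fst t) - (\<xi> \<bullet> fst s) * (\<xi> \<bullet> fst t) - S y (fst s) (fst t)"
    and G: "bilinear (G x)" "\<And>a b. G x a b = G x b a" "\<And>a b. (\<lambda>y. G y a b) differentiable (at x)"
    and S: "bilinear (S x)" "\<And>a b. S x a b = S x b a" "\<And>a. (\<And>b. S x a b = 0) \<Longrightarrow> a = 0"
    and dS: "\<And>a b. ((\<lambda>y. S y a b) has_derivative (\<lambda>t. dS t a b)) (at x)"
      "\<And>t. bilinear (dS t)" "\<And>t a b. dS t a b = dS t b a"
    and zero: "second_fundamental_form h zero_section x u v = 0"
  shows "S x (G x u v) w = (dS u v w + dS v u w - dS w u v) / 2"
proof -
  let ?z = "(x, 0::real^2)"
  \<comment> \<open>The derivative of \<open>h\<close> at a point of the zero section.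
    Differentiating in the fibre leaves only \<open>G\<close>, and along the base only
    \<open>S\<close>.\<close>
  define dh where "dh t p q = - (snd t \<bullet> G x (fst p) (fst q)) - dS (fst t) (fst p) (fst q)"
    for t p q :: "(real^2) \<times> (real^2)"
  have hz: "h ?z s t = (snd s \<bullet> fst t + snd t \<bullet> fst s) / 2 - S x (fst s) (fst t)" for s t
    using h[OF V(2), of 0] by simp
  note lS = bilinear_ladd[OF S(1)] bilinear_radd[OF S(1)] bilinear_lmul[OF S(1)] bilinear_rmul[OF S(1)]
  note lG = bilinear_ladd[OF G(1)] bilinear_radd[OF G(1)] bilinear_lmul[OF G(1)] bilinear_rmul[OF G(1)]
  note ldS = bilinear_ladd[OF dS(2)] bilinear_radd[OF dS(2)] bilinear_lmul[OF dS(2)] bilinear_rmul[OF dS(2)]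
  have b: "bilinear (h ?z)"
    unfolding bilinear_def by (auto intro!: linearI simp: hz lS inner_simps field_simps)
  have sym: "h ?z s t = h ?z t s" for s t by (simp add: hz S(2)[of "fst s"])
  \<comment> \<open>The vertical test vector \<open>(0, fst s)\<close> gives half the squared length
    of \<open>fst s\<close>; with \<open>fst s = 0\<close>, the test vector
    \<open>(snd s, 0)\<close> does the same for \<open>snd s\<close>.\<close>
  have nondeg: "s = 0" if "\<And>t. h ?z s t = 0" for s
  proof -
    have 1: "fst s = 0" using that[of "(0, fst s)"] bilinear_rzero[OF S(1)] by (simp add: hz)
    then have "snd s = 0" using that[of "(snd s, 0)"] bilinear_lzero[OF S(1)] by (simp add: hz)
    with 1 show ?thesis by (simp add: prod_eq_iff)
  qed
  have db: "bilinear (dh t)" for t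
    unfolding bilinear_def by (auto intro!: linearI simp: dh_def lG ldS inner_simps algebra_simps)
  have dsym: "dh t p q = dh t q p" for t p q
    by (simp add: dh_def G(2)[of "fst p"] dS(3)[of _ "fst p"])
  have der: "((\<lambda>y. h y p q) has_derivative (\<lambda>t. dh t p q)) (at ?z)" for p q
  proof -
    have f: "((\<lambda>z. fst z) has_derivative fst) (at ?z)"
      by (rule bounded_linear_imp_has_derivative[OF bounded_linear_fst])
    obtain dG where "((\<lambda>y. G y (fst p) (fst q)) has_derivative dG) (at x)"
      using G(3) unfolding differentiable_def by blast
    then have 1: "((\<lambda>z. G (fst z) (fst p) (fst q)) has_derivative (\<lambda>t. dG (fst t))) (at ?z)"
      using has_derivative_compose[OF f, of "\<lambda>y. G y (fst p) (fst q)" dG] by simp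
    have 2: "((\<lambda>z. S (fst z) (fst p) (fst q)) has_derivative (\<lambda>t. dS (fst t) (fst p) (fst q))) (at ?z)"
      using has_derivative_compose[OF f, of "\<lambda>y. S y (fst p) (fst q)" "\<lambda>t. dS t (fst p) (fst q)"] dS(1) by simp
    have 3: "((\<lambda>z. (snd p \<bullet> fst q + snd q \<bullet> fst p) / 2
      - snd z \<bullet> G (fst z) (fst p) (fst q) - (snd z \<bullet> fst p) * (snd z \<bullet> fst q) - S (fst z) (fst p) (fst q))
      has_derivative (\<lambda>t. dh t p q)) (at ?z)"
      by (rule derivative_eq_intros 1 2 refl | simp add: dh_def)+
    show ?thesis
      by (rule has_derivative_transform_within_open[OF 3, of "V \<times> UNIV"])
        (use V h[of _ _ p q] in \<open>auto simp: open_Times\<close>)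
  qed
  note koszul = lc_christoffel_koszul[where h = h and z = ?z, OF b sym nondeg der db dsym]
  have fr: "frechet_derivative zero_section (at y) = (\<lambda>a. (a, 0))" for y
    unfolding zero_section_def
    by (rule frechet_derivative_eq) (auto intro!: derivative_eq_intros)
  let ?\<Gamma> = "lc_christoffel h ?z (u, 0) (v, 0)"
  \<comment> \<open>The differential of the zero section is the same at every point, so its
    derivative vanishes and only the Christoffel term remains.\<close>
  have "normal_component (h ?z) (range (\<lambda>a. (a, 0))) ?\<Gamma> = 0"
    using zero unfolding second_fundamental_form_def fr Let_def by (simp add: zero_section_def)
  then have "snd ?\<Gamma> = 0"
    by (rule zero_normal_component[OF b, rotated]) (use S(3) in \<open>simp add: hz\<close>)
  then have k: "(\<omega> \<bullet> fst ?\<Gamma>) / 2 - S x (fst ?\<Gamma>) w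
      = (\<omega> \<bullet> G x u v - dS u v w - dS v u w + dS w u v) / 2" for w \<omega>
    using koszul[of "(u, 0)" "(v, 0)" "(w, \<omega>)"] by (simp add: hz dh_def)
  \<comment> \<open>Taking \<open>w = 0\<close> isolates the covector part of \<open>k\<close> and
    identifies the base component; \<open>\<omega> = 0\<close> below then leaves the identity for
    \<open>S\<close>.\<close>
  have "\<omega> \<bullet> fst ?\<Gamma> = \<omega> \<bullet> G x u v" for \<omega>
    using k[of \<omega> 0] bilinear_rzero[OF S(1)] bilinear_rzero[OF dS(2)] bilinear_lzero[OF dS(2)]
      linear_0[OF has_derivative_linear[OF dS(1)]] by simp
  then have "fst ?\<Gamma> = G x u v" using vector_eq_ldot by blast
  then show ?thesis using k[of 0 w] by simp
qed

section \<open>The Ricci tensor as a metric\<close>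

context smooth_surface begin

section \<open>Uniqueness of the Levi-Civita connection and of its curvature\<close>

lemma levi_civita_tf_connection:
  assumes "levi_civita A g D" shows "tf_connection A D"
  using assms[unfolded levi_civita_def, THEN conjunct1]
    assms[unfolded levi_civita_def, THEN conjunct2, THEN conjunct1]
  by (intro tf_connection.intro tf_connection_axioms.intro smooth_surface_axioms)

lemma levi_civita_unique:
  assumes g: "riemannian_metric A g" and lc: "levi_civita A g D" "levi_civita A g D'"
    and W: "open W" "p \<in> W" and XY: "smooth_field A W X" "smooth_field A W Y"
  shows "D X Y p = D' X Y p"
proof -
  interpret D: tf_connection A D by (rule levi_civita_tf_connection[OF lc(1)])
  interpret D': tf_connection A D' by (rule levi_civita_tf_connection[OF lc(2)])
  define T where "T X Y = D X Y - D' X Y" for X Y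
  have T: "smooth_field A W (T X Y)" if "smooth_field A W X" "smooth_field A W Y" for X Y
    unfolding T_def by (rule smooth_field_diff[OF W(1) D.D_smooth[OF W(1) that] D'.D_smooth[OF W(1) that]])
  note t = smooth_field_tangent[OF _ W(2)]
  note lin = g[unfolded riemannian_metric_def, THEN conjunct1, rule_format, of _ p]
  note g_sym = lin[THEN conjunct1] and g_add = lin[THEN conjunct2, THEN conjunct1]
    and g_scale = lin[THEN conjunct2, THEN conjunct2]
  have g_diff: "g p (u - w) v = g p u v - g p w v"
    if "u \<in> tangent_space A p" "v \<in> tangent_space A p" "w \<in> tangent_space A p" for u v w
    using g_add[OF that(1,2) tangent_scale[OF that(3), of "-1"]] g_scale[OF that(3,2,3), of "-1"]
    by (simp add: vscale_simps)
  note metric = lc[unfolded levi_civita_def, THEN conjunct2, THEN conjunct2, rule_format, OF W(1) _ _ _ W(2)]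
  have skew: "g p (T X Y p) (Z p) = - g p (T X Z p) (Y p)"
    if "smooth_field A W X" "smooth_field A W Y" "smooth_field A W Z" for X Y Z
  proof -
    note tt = t[OF that(2)] t[OF that(3)] t[OF D.D_smooth[OF W(1) that(1,2)]] t[OF D.D_smooth[OF W(1) that(1,3)]]
      t[OF D'.D_smooth[OF W(1) that(1,2)]] t[OF D'.D_smooth[OF W(1) that(1,3)]]
    show ?thesis using metric[OF that] g_sym[OF tt(1) tt(4) tt(4)] g_sym[OF tt(1) tt(6) tt(6)]
      by (simp add: T_def g_diff tt)
  qed
  have T_sym: "T X Y p = T Y X p" if "smooth_field A W X" "smooth_field A W Y" for X Y
    using D.torsion_eq[OF W(1) that W(2)] D'.torsion_eq[OF W(1) that W(2)]
    by (simp add: T_def algebra_simps)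
  \<comment> \<open>A trilinear form symmetric in its first two slots and skew in its last two
    vanishes: alternating the two exchanges six times returns to the start with the opposite sign.
    Definiteness then applies with \<open>Z = T X Y\<close>.\<close>
  have "g p (T X Y p) (Z p) = 0" if Z: "smooth_field A W Z" for Z
    using skew[OF XY Z] skew[OF Z XY] skew[OF XY(2) Z XY(1)] T_sym[OF XY(1) Z] T_sym[OF XY]
      T_sym[OF XY(2) Z] by simp
  then have "g p (T X Y p) (T X Y p) = 0" using T[OF XY] by blast
  then have "T X Y p = 0"
    using g[unfolded riemannian_metric_def, THEN conjunct2, THEN conjunct1, rule_format, OF t[OF T[OF XY]]]
    by (cases "T X Y p = 0") simp_all
  then show ?thesis by (simp add: T_def)
qed

text \<open>\<open>gauss_curvature\<close> uses a connection selected by \<open>SOME\<close>; this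
  transfers its curvature to the given one. The inner derivatives agree on all of \<open>W\<close>,
  so locality (\<open>D_cong\<close>) allows exchanging them before the outer ones.\<close>

lemma levi_civita_curvature_unique:
  assumes g: "riemannian_metric A g" and lc: "levi_civita A g D" "levi_civita A g D'"
    and W: "open W" "p \<in> W" and X: "smooth_field A W X" "smooth_field A W Y" "smooth_field A W Z"
  shows "curvature A D X Y Z p = curvature A D' X Y Z p"
proof -
  interpret D: tf_connection A D by (rule levi_civita_tf_connection[OF lc(1)])
  interpret D': tf_connection A D' by (rule levi_civita_tf_connection[OF lc(2)])
  note u = levi_civita_unique[OF g lc W(1)]
  have "D U (D V Z) p = D' U (D' V Z) p" if "smooth_field A W U" "smooth_field A W V" for U V
  proof -
    have "D U (D V Z) p = D U (D' V Z) p"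
      by (rule D.D_cong[OF W(1)]) (use that X W u D.D_smooth[OF W(1)] D'.D_smooth[OF W(1)] in auto)
    also have "\<dots> = D' U (D' V Z) p"
      by (rule u) (use that X W D'.D_smooth[OF W(1)] in auto)
    finally show ?thesis .
  qed
  then show ?thesis
    using u[OF W(2) D.smooth_lie_bracket[OF W(1) X(1,2)] X(3)] X by (simp add: curvature_def)
qed

text \<open>Constant components in the chart around \<open>p\<close> give a field that is smooth on
  the whole chart domain; for tensorial expressions any other smooth extension would give the same
  value.\<close>

definition extend :: "'a \<Rightarrow> 'a tvec \<Rightarrow> 'a vfield" where
  "extend p u = (\<lambda>q. coord_vec A (chart_at A p) q (components (chart_at A p) u))"

end

section \<open>The Ricci tensor as a form on tangent vectors\<close>

context tf_connection begin

lemma smooth_extend: "smooth_field A (chart_dom (chart_at A p)) (extend p u)"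
  unfolding extend_def by (rule smooth_field_const[OF chart_at(1)])

lemma extend_self: "u \<in> tangent_space A p \<Longrightarrow> extend p u p = u"
  unfolding extend_def by (rule tangent_rep[OF _ chart_at])

lemma ricci_expand:
  assumes W: "open W" "p \<in> W" and X: "smooth_field A W X" and Y: "smooth_field A W Y"
    and c: "c \<in> A" "p \<in> chart_dom c"
  shows "ricci A D X Y p = (\<Sum>i\<in>UNIV. \<Sum>j\<in>UNIV. components c (X p) $ i * components c (Y p) $ j *
    ricci A D (coord_field A c i) (coord_field A c j) p)"
proof -
  have "ricci A D X Y p = (\<Sum>i\<in>UNIV. components c (X p) $ i * ricci A D (coord_field A c i) Y p)"
    by (rule tensorial_expand[OF tensorial_ricci(1)[OF W Y] W X c])
  moreover have "ricci A D (coord_field A c i) Y p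
      = (\<Sum>j\<in>UNIV. components c (Y p) $ j * ricci A D (coord_field A c i) (coord_field A c j) p)" for i
    by (rule tensorial_expand[OF tensorial_ricci(2)[OF open_dom[OF c(1)] c(2) smooth_field_coord[OF c(1)]] W Y c])
      simp
  ultimately show ?thesis by (simp add: sum_distrib_left mult.assoc)
qed

text \<open>A metric takes vectors while \<open>ricci\<close> takes fields, hence the extensions;
  \<open>ricci_metric_field\<close> shows that they leave no trace.\<close>

definition ricci_metric :: "real \<Rightarrow> 'a metric" where
  "ricci_metric \<epsilon> p u v = \<epsilon> * ricci A D (extend p u) (extend p v) p"

lemma ricci_metric_field:
  assumes W: "open W" "p \<in> W" and X: "smooth_field A W X" and Y: "smooth_field A W Y"
  shows "ricci_metric \<epsilon> p (X p) (Y p) = \<epsilon> * ricci A D X Y p"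
proof -
  let ?V = "chart_dom (chart_at A p)"
  have V: "open ?V" "p \<in> ?V" using chart_at open_dom by auto
  note e = extend_self[OF smooth_field_tangent[OF X W(2)]] extend_self[OF smooth_field_tangent[OF Y W(2)]]
  have "ricci A D (extend p (X p)) (extend p (Y p)) p = ricci A D X (extend p (Y p)) p"
    by (rule tensorial_point[OF tensorial_ricci(1)[OF V smooth_extend] V smooth_extend W X]) (simp add: e)
  also have "\<dots> = ricci A D X Y p"
    by (rule tensorial_point[OF tensorial_ricci(2)[OF W X] V smooth_extend W Y]) (simp add: e)
  finally show ?thesis by (simp add: ricci_metric_def)
qed

end

text \<open>Symmetry is the Lagrangian condition, and \<epsilon> is the sign that makes the Ricci
  form positive.\<close>

locale definite_ricci = tf_connection A D
  for A :: "'a::{t2_space, second_countable_topology} chart set" and D :: "'a covd" +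
  fixes \<epsilon> :: real
  assumes ricci_symmetric: "open W \<Longrightarrow> p \<in> W \<Longrightarrow> smooth_field A W X \<Longrightarrow> smooth_field A W Y \<Longrightarrow>
      ricci A D X Y p = ricci A D Y X p"
    and ricci_definite: "open W \<Longrightarrow> p \<in> W \<Longrightarrow> smooth_field A W X \<Longrightarrow> X p \<noteq> 0 \<Longrightarrow> \<epsilon> * ricci A D X X p > 0"
begin

lemma riemannian_ricci_metric: "riemannian_metric A (ricci_metric \<epsilon>)"
  unfolding riemannian_metric_def
proof (intro conjI allI ballI impI)
  fix p u v w r
  assume u: "u \<in> tangent_space A p" and v: "v \<in> tangent_space A p" and w: "w \<in> tangent_space A p"
  let ?V = "chart_dom (chart_at A p)"
  have V: "open ?V" "p \<in> ?V" using chart_at open_dom by auto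
  note s = smooth_extend[of p] and e = extend_self[OF u] extend_self[OF v] extend_self[OF w]
  show "ricci_metric \<epsilon> p u v = ricci_metric \<epsilon> p v u"
    unfolding ricci_metric_def using ricci_symmetric[OF V s s] by simp
  have "ricci_metric \<epsilon> p ((extend p u + extend p w) p) (extend p v p)
      = \<epsilon> * ricci A D (extend p u + extend p w) (extend p v) p"
    by (rule ricci_metric_field[OF V smooth_field_add[OF V(1) s s] s])
  also have "\<dots> = ricci_metric \<epsilon> p u v + ricci_metric \<epsilon> p w v"
    unfolding ricci_metric_def tensorial_add[OF tensorial_ricci(1)[OF V s] V s s] by (simp add: distrib_left)
  finally show "ricci_metric \<epsilon> p (u + w) v = ricci_metric \<epsilon> p u v + ricci_metric \<epsilon> p w v"
    by (simp add: e)
  have "ricci_metric \<epsilon> p (field_scale (\<lambda>q. r) (extend p u) p) (extend p v p)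
      = \<epsilon> * ricci A D (field_scale (\<lambda>q. r) (extend p u)) (extend p v) p"
    by (rule ricci_metric_field[OF V smooth_field_scale[OF V(1) smooth_fun_const s] s])
  also have "\<dots> = r * ricci_metric \<epsilon> p u v"
    unfolding ricci_metric_def tensorial_scale[OF tensorial_ricci(1)[OF V s] V s smooth_fun_const] by simp
  finally show "ricci_metric \<epsilon> p (vscale r u) v = r * ricci_metric \<epsilon> p u v"
    by (simp add: e field_scale_apply)
next
  fix p v assume v: "v \<in> tangent_space A p" "v \<noteq> 0"
  let ?V = "chart_dom (chart_at A p)"
  have V: "open ?V" "p \<in> ?V" using chart_at open_dom by auto
  show "ricci_metric \<epsilon> p v v > 0"
    unfolding ricci_metric_def using ricci_definite[OF V smooth_extend] extend_self[OF v(1)] v(2) by simp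
next
  fix W X Y assume W: "open W" and X: "smooth_field A W X" and Y: "smooth_field A W Y"
  have "smooth_fun A W (\<lambda>p. \<epsilon> * ricci A D X Y p)"
    by (intro smooth_fun_mult[OF W] smooth_fun_const smooth_ricci[OF W X Y])
  then show "smooth_fun A W (\<lambda>p. ricci_metric \<epsilon> p (X p) (Y p))"
    by (rule smooth_fun_cong[OF W, rotated]) (simp add: ricci_metric_field[OF W _ X Y])
qed

text \<open>The covariant derivative of Ric along \<open>X\<close>, evaluated on \<open>Y\<close>
  and \<open>Z\<close>. Its vanishing is metric compatibility for every constant multiple of
  Ric.\<close>

definition metric_defect :: "'a \<Rightarrow> 'a vfield \<Rightarrow> 'a vfield \<Rightarrow> 'a vfield \<Rightarrow> real" where
  "metric_defect p X Y Z = X p (\<lambda>q. ricci A D Y Z q) - ricci A D (D X Y) Z p - ricci A D Y (D X Z) p"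

lemma metric_defect_sym:
  assumes W: "open W" "p \<in> W" and X: "smooth_field A W X" "smooth_field A W Y" "smooth_field A W Z"
  shows "metric_defect p X Y Z = metric_defect p X Z Y"
proof -
  have "X p (\<lambda>q. ricci A D Y Z q) = X p (\<lambda>q. ricci A D Z Y q)"
    by (rule tvec_local[OF smooth_field_tangent[OF X(1) W(2)] W]) (rule ricci_symmetric[OF W(1) _ X(2,3)])
  then show ?thesis
    using ricci_symmetric[OF W D_smooth[OF W(1) X(1,2)] X(3)] ricci_symmetric[OF W X(2) D_smooth[OF W(1) X(1,3)]]
    by (simp add: metric_defect_def)
qed

text \<open>In the second part the term \<open>(Y f) Ric(X, Z)\<close> arises from differentiating
  the function and again from the Leibniz rule for \<open>D Y (f X)\<close>, with opposite
  signs.\<close>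

lemma tensorial_metric_defect:
  assumes W: "open W" "p \<in> W" and Y: "smooth_field A W Y" and Z: "smooth_field A W Z"
  shows "tensorial p (\<lambda>X. metric_defect p X Y Z)" and "tensorial p (\<lambda>X. metric_defect p Y X Z)"
proof -
  show "tensorial p (\<lambda>X. metric_defect p X Y Z)"
  proof (rule tensorialI[OF W])
    fix V X X' assume V: "open V" "p \<in> V" "V \<subseteq> W" and X: "smooth_field A V X" "smooth_field A V X'"
    note Y = smooth_field_subset[OF Y V(3)] and Z = smooth_field_subset[OF Z V(3)]
    note s = X Y Z smooth_field_add[OF V(1)] D_smooth[OF V(1)]
    note r = tensorial_ricci[OF V(1,2)]
    have "ricci A D (D (X + X') Y) Z p = ricci A D (D X Y + D X' Y) Z p"
      by (rule tensorial_cong[OF r(1)[OF Z] V(1,2)]) (auto simp: s D_add_left[OF V(1)])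
    moreover have "ricci A D Y (D (X + X') Z) p = ricci A D Y (D X Z + D X' Z) p"
      by (rule tensorial_cong[OF r(2)[OF Y] V(1,2)]) (auto simp: s D_add_left[OF V(1)])
    ultimately show "metric_defect p (X + X') Y Z = metric_defect p X Y Z + metric_defect p X' Y Z"
      by (simp add: metric_defect_def tensorial_add[OF r(1)[OF Z] V(1,2)] tensorial_add[OF r(2)[OF Y] V(1,2)] s)
  next
    fix V X f assume V: "open V" "p \<in> V" "V \<subseteq> W" and X: "smooth_field A V X" "smooth_fun A V f"
    note Y = smooth_field_subset[OF Y V(3)] and Z = smooth_field_subset[OF Z V(3)]
    note s = X Y Z smooth_field_scale[OF V(1)] D_smooth[OF V(1)]
    note r = tensorial_ricci[OF V(1,2)]
    have "ricci A D (D (field_scale f X) Y) Z p = ricci A D (field_scale f (D X Y)) Z p"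
      by (rule tensorial_cong[OF r(1)[OF Z] V(1,2)]) (auto simp: s D_scale_left[OF V(1)] field_scale_apply)
    moreover have "ricci A D Y (D (field_scale f X) Z) p = ricci A D Y (field_scale f (D X Z)) p"
      by (rule tensorial_cong[OF r(2)[OF Y] V(1,2)]) (auto simp: s D_scale_left[OF V(1)] field_scale_apply)
    ultimately show "metric_defect p (field_scale f X) Y Z = f p * metric_defect p X Y Z"
      by (simp add: metric_defect_def tensorial_scale[OF r(1)[OF Z] V(1,2)] tensorial_scale[OF r(2)[OF Y] V(1,2)] s
        field_scale_apply vscale_def right_diff_distrib)
  qed
  show "tensorial p (\<lambda>X. metric_defect p Y X Z)"
  proof (rule tensorialI[OF W])
    fix V X X' assume V: "open V" "p \<in> V" "V \<subseteq> W" and X: "smooth_field A V X" "smooth_field A V X'"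
    note Y = smooth_field_subset[OF Y V(3)] and Z = smooth_field_subset[OF Z V(3)]
    note s = X Y Z smooth_field_add[OF V(1)] D_smooth[OF V(1)]
    note r = tensorial_ricci(1)[OF V(1,2)] and t = smooth_field_tangent[OF Y V(2)]
    have sm: "smooth_at A p (\<lambda>q. ricci A D U Z q)" if "smooth_field A V U" for U
      by (rule smooth_atI[OF V(1,2) smooth_ricci[OF V(1) that Z]])
    have "Y p (\<lambda>q. ricci A D (X + X') Z q) = Y p (\<lambda>q. ricci A D X Z q + ricci A D X' Z q)"
      by (rule tvec_local[OF t V(1,2)]) (rule tensorial_add[OF tensorial_ricci(1)[OF V(1) _ Z] V(1) _ X])
    moreover have "ricci A D (D Y (X + X')) Z p = ricci A D (D Y X + D Y X') Z p"
      by (rule tensorial_cong[OF r[OF Z] V(1,2)]) (auto simp: s D_add_right[OF V(1)])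
    ultimately show "metric_defect p Y (X + X') Z = metric_defect p Y X Z + metric_defect p Y X' Z"
      by (simp add: metric_defect_def tvec_add[OF t sm sm] tensorial_add[OF r V(1,2)] s)
  next
    fix V X f assume V: "open V" "p \<in> V" "V \<subseteq> W" and X: "smooth_field A V X" "smooth_fun A V f"
    note Y = smooth_field_subset[OF Y V(3)] and Z = smooth_field_subset[OF Z V(3)]
    note s = X Y Z smooth_field_scale[OF V(1)] smooth_field_add[OF V(1)] D_smooth[OF V(1)] smooth_field_apply[OF V(1)]
    note r = tensorial_ricci(1)[OF V(1,2)] and t = smooth_field_tangent[OF Y V(2)]
    have sm: "smooth_at A p (\<lambda>q. ricci A D X Z q)" "smooth_at A p f"
      using smooth_atI[OF V(1,2)] smooth_ricci[OF V(1) X(1) Z] X(2) by auto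
    have "Y p (\<lambda>q. ricci A D (field_scale f X) Z q) = Y p (\<lambda>q. f q * ricci A D X Z q)"
      by (rule tvec_local[OF t V(1,2)]) (rule tensorial_scale[OF tensorial_ricci(1)[OF V(1) _ Z] V(1) _ X])
    moreover have "ricci A D (D Y (field_scale f X)) Z p
        = ricci A D (field_scale (\<lambda>q. Y q f) X + field_scale f (D Y X)) Z p"
      by (rule tensorial_cong[OF r[OF Z] V(1,2)]) (auto simp: s D_scale_right[OF V(1)] field_scale_apply)
    ultimately show "metric_defect p Y (field_scale f X) Z = f p * metric_defect p Y X Z"
      by (simp add: metric_defect_def tvec_mult[OF t sm(2,1)] tensorial_add[OF r V(1,2)]
        tensorial_scale[OF r V(1,2)] s algebra_simps)
  qed
qed

lemma metric_defect_zero: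
  assumes c: "c \<in> A" "p \<in> chart_dom c"
    and z: "\<And>i j k. metric_defect p (coord_field A c i) (coord_field A c j) (coord_field A c k) = 0"
    and W: "open W" "p \<in> W" and X: "smooth_field A W X" "smooth_field A W Y" "smooth_field A W Z"
  shows "metric_defect p X Y Z = 0"
proof -
  have V: "open (W \<inter> chart_dom c)" "p \<in> W \<inter> chart_dom c" using W c open_dom[OF c(1)] by auto
  have s: "smooth_field A (W \<inter> chart_dom c) (coord_field A c i)" for i using smooth_field_coord[OF c(1)] by blast
  note X = X[THEN smooth_field_subset[of W _ "W \<inter> chart_dom c"], simplified]
  \<comment> \<open>Symmetry in the last two slots turns the third slot into the second, where
    tensoriality is available.\<close>
  have 1: "metric_defect p (coord_field A c i) (coord_field A c j) Z = 0" for i j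
    unfolding metric_defect_sym[OF V s s X(3)]
    using tensorial_expand[OF tensorial_metric_defect(2)[OF V s s] V X(3) c]
    by (simp add: z)
  have 2: "metric_defect p (coord_field A c i) Y Z = 0" for i
    using tensorial_expand[OF tensorial_metric_defect(2)[OF V s X(3)] V X(2) c] by (simp add: 1)
  show ?thesis
    using tensorial_expand[OF tensorial_metric_defect(1)[OF V X(2,3)] V X(1) c] by (simp add: 2)
qed

lemma levi_civita_ricci_metric:
  assumes z: "\<And>c p i j k. c \<in> A \<Longrightarrow> p \<in> chart_dom c \<Longrightarrow>
    metric_defect p (coord_field A c i) (coord_field A c j) (coord_field A c k) = 0"
  shows "levi_civita A (ricci_metric \<epsilon>) D"
  unfolding levi_civita_def
proof (intro conjI connection torsion allI impI ballI)
  fix W X Y Z p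
  assume W: "open W" "p \<in> W" and X: "smooth_field A W X" "smooth_field A W Y" "smooth_field A W Z"
  note t = smooth_field_tangent[OF X(1) W(2)]
  have "X p (\<lambda>q. ricci_metric \<epsilon> q (Y q) (Z q)) = X p (\<lambda>q. \<epsilon> * ricci A D Y Z q)"
    by (rule tvec_local[OF t W]) (rule ricci_metric_field[OF W(1) _ X(2,3)])
  also have "\<dots> = \<epsilon> * X p (\<lambda>q. ricci A D Y Z q)"
    by (rule tvec_cmult[OF t smooth_atI[OF W smooth_ricci[OF W(1) X(2,3)]]])
  also have "X p (\<lambda>q. ricci A D Y Z q) = ricci A D (D X Y) Z p + ricci A D Y (D X Z) p"
  proof -
    obtain c where "c \<in> A" "p \<in> chart_dom c" by (rule ex_chart)
    from metric_defect_zero[OF this z[OF this] W X] show ?thesis by (simp add: metric_defect_def)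
  qed
  finally show "X p (\<lambda>q. ricci_metric \<epsilon> q (Y q) (Z q))
      = ricci_metric \<epsilon> p (D X Y p) (Z p) + ricci_metric \<epsilon> p (Y p) (D X Z p)"
    using ricci_metric_field[OF W D_smooth[OF W(1) X(1,2)] X(3)] ricci_metric_field[OF W X(2) D_smooth[OF W(1) X(1,3)]]
    by (simp add: distrib_left)
qed

end

section \<open>Totally geodesic connections\<close>

context definite_ricci begin

lemma metric_defect_coord:
  assumes tg: "totally_geodesic A D" and c: "c \<in> A" "p \<in> chart_dom c"
  shows "metric_defect p (coord_field A c k) (coord_field A c i) (coord_field A c j) = 0"
proof -
  let ?e = "coord_field A c" and ?x = "chart_map c p"
  let ?V = "im c (chart_dom c)"
  let ?\<Gamma> = "christoffel A D c" and ?S = "schouten_coord A D c"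
  note o = open_dom[OF c(1)] and e = smooth_field_coord[OF c(1) order_refl]
  have V: "open ?V" "?x \<in> ?V" using open_im[OF c(1) o] c by auto
  \<comment> \<open>The Lagrangian condition kills the skew part, so the Schouten coefficients are
    those of Ricci.\<close>
  have S_ricci: "?S i j y = ricci A D (?e i) (?e j) (chart_inv c y)" if "y \<in> ?V" for i j y
    using ricci_symmetric[OF o imE(1)[OF that c(1)] e e, of i j]
    by (simp add: schouten_coord_def schouten_def ricci_sym_def ricci_skew_def)
  have S_sym: "?S i j y = ?S j i y" if "y \<in> ?V" for i j y
    using ricci_symmetric[OF o imE(1)[OF that c(1)] e e, of i j] S_ricci[OF that] by simp
  have \<Gamma>_sym: "?\<Gamma> k i j y = ?\<Gamma> k j i y" if "y \<in> ?V" for k i j y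
  proof -
    note q = imE(1)[OF that c(1)]
    have "components c (D (?e i) (?e j) (chart_inv c y) - D (?e j) (?e i) (chart_inv c y)) = 0"
      unfolding torsion_eq[OF o e e q] by (rule components_lie_bracket_coord[OF c(1) q])
    then show ?thesis unfolding christoffel_def components_diff by (metis right_minus_eq)
  qed
  have S_smooth: "smooth_on ?V (?S i j)" for i j
    by (rule smooth_on_cong[OF V(1) _ smooth_funD[OF smooth_ricci[OF o e e] c(1)]]) (rule S_ricci[symmetric])
  have \<Gamma>_smooth: "smooth_on ?V (?\<Gamma> k i j)" for k i j
    using smooth_funD[OF smooth_field_components[OF o D_smooth[OF o e e] c(1)] c(1)]
    unfolding christoffel_def by simp
  define G where "G y a b = (\<chi> k. \<Sum>i\<in>UNIV. \<Sum>j\<in>UNIV. ?\<Gamma> k i j y * a $ i * b $ j)" for y and a b :: "real^2"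
  define S where "S y a b = (\<Sum>i\<in>UNIV. \<Sum>j\<in>UNIV. ?S i j y * a $ i * b $ j)" for y and a b :: "real^2"
  define dS where "dS t a b = (\<Sum>i\<in>UNIV. \<Sum>j\<in>UNIV. frechet_derivative (?S i j) (at ?x) t * a $ i * b $ j)"
    for t a b :: "real^2"
  \<comment> \<open>Symmetrising \<open>psi_form\<close> averages its coefficients over the two base
    indices; the symmetry of \<open>\<Gamma>\<close> (no torsion) and of \<open>S\<close> makes the
    average equal to the coefficient.\<close>
  have h: "cotangent_metric A D c (y, \<xi>) s t = (snd s \<bullet> fst t + snd t \<bullet> fst s) / 2
      - \<xi> \<bullet> G y (fst s) (fst t) - (\<xi> \<bullet> fst s) * (\<xi> \<bullet> fst t) - S y (fst s) (fst t)"
    if "y \<in> ?V" for y \<xi> s t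
    using \<Gamma>_sym[OF that, of _ 2 1] S_sym[OF that, of 2 1]
    by (cases s; cases t) (simp add: cotangent_metric_def psi_form_def G_def S_def sum_2 inner_vec_def
        field_simps)
  have bG: "bilinear (G ?x)"
    unfolding bilinear_def by (auto intro!: linearI simp: G_def sum_2 vec_eq_iff algebra_simps)
  have bS: "bilinear (S ?x)"
    unfolding bilinear_def by (auto intro!: linearI simp: S_def sum_2 algebra_simps)
  have bdS: "bilinear (dS t)" for t
    unfolding bilinear_def by (auto intro!: linearI simp: dS_def sum_2 algebra_simps)
  have G_sym: "G ?x a b = G ?x b a" for a b
    using \<Gamma>_sym[OF V(2), of _ 2 1] by (simp add: G_def sum_2 vec_eq_iff algebra_simps)
  have SS_sym: "S ?x a b = S ?x b a" for a b
    using S_sym[OF V(2), of 2 1] by (simp add: S_def sum_2 algebra_simps)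
  have dS_sym: "dS t a b = dS t b a" for t a b
    using frechet_derivative_cong_open(1)[OF V, of "?S 2 1" "?S 1 2", OF S_sym] by (simp add: dS_def sum_2 algebra_simps)
  have dG: "(\<lambda>y. G y a b) differentiable (at ?x)" for a b
  proof -
    have "smooth_on ?V (\<lambda>y. G y a b)"
      unfolding smooth_on_vec_iff[OF V(1)] G_def vec_lambda_beta
      by (intro allI smooth_on_sum[OF V(1)] smooth_on_mult[OF V(1)] smooth_on_const \<Gamma>_smooth)
    then show ?thesis using V(2) by (rule smooth_on_differentiable)
  qed
  have dS: "((\<lambda>y. S y a b) has_derivative (\<lambda>t. dS t a b)) (at ?x)" for a b
    unfolding S_def dS_def
    by (intro has_derivative_sum has_derivative_mult_left has_derivative_frechet
        smooth_on_differentiable[OF S_smooth V(2)])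
  have S_field: "S ?x (components c (X p)) (components c (Y p)) = ricci A D X Y p"
    if "smooth_field A (chart_dom c) X" "smooth_field A (chart_dom c) Y" for X Y
    unfolding ricci_expand[OF o c(2) that c] S_def using S_ricci[OF V(2)] c by (simp add: mult_ac)
  have S_nondeg: "a = 0" if "\<And>b. S ?x a b = 0" for a
  proof (rule ccontr)
    assume "a \<noteq> 0"
    let ?X = "\<lambda>q. coord_vec A c q a"
    have "?X p \<noteq> 0" using \<open>a \<noteq> 0\<close> components_coord_vec[OF c, of a] components_zero by metis
    from ricci_definite[OF o c(2) smooth_field_const[OF c(1)] this]
    show False using S_field[OF smooth_field_const[OF c(1), of a] smooth_field_const[OF c(1), of a]] that[of a] c
      by simp
  qed
  have koszul: "S ?x (G ?x u v) w = (dS u v w + dS v u w - dS w u v) / 2" for u v w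
  proof (rule zero_section_second_fundamental_form[OF V h bG G_sym dG bS SS_sym S_nondeg dS bdS dS_sym])
    show "second_fundamental_form (cotangent_metric A D c) zero_section ?x u v = 0"
      using tg c unfolding totally_geodesic_def by blast
  qed
  \<comment> \<open>The sum of the two Koszul identities for \<open>(t, a, b)\<close> and
    \<open>(t, b, a)\<close>: this is the coordinate form of a parallel Ricci tensor.\<close>
  have "dS t a b = S ?x (G ?x t a) b + S ?x a (G ?x t b)" for t a b
    using koszul[of t a b] koszul[of t b a] dS_sym[of t a b] dS_sym[of a t b] dS_sym[of b t a]
      SS_sym[of a "G ?x t b"] by (simp add: field_simps)
  note this[of "axis k 1" "axis i 1" "axis j 1"]
  moreover have "G ?x (axis a 1) (axis b 1) = components c (D (?e a) (?e b) p)" for a b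
    using c by (simp add: G_def coord_bilinear_axis christoffel_def vec_eq_iff)
  moreover have "S ?x (components c (D (?e a) (?e b) p)) (axis m 1) = ricci A D (D (?e a) (?e b)) (?e m) p"
    "S ?x (axis m 1) (components c (D (?e a) (?e b) p)) = ricci A D (?e m) (D (?e a) (?e b)) p" for a b m
    using S_field[OF D_smooth[OF o e e] e, of a b m] S_field[OF e D_smooth[OF o e e], of m a b] c by auto
  moreover have "dS (axis k 1) (axis i 1) (axis j 1) = ?e k p (\<lambda>q. ricci A D (?e i) (?e j) q)"
  proof -
    have "?e k p (\<lambda>q. ricci A D (?e i) (?e j) q)
        = frechet_derivative (\<lambda>y. ricci A D (?e i) (?e j) (chart_inv c y)) (at ?x) (axis k 1)"
      unfolding coord_field_def[of A c k]
      by (rule coord_vec_apply[OF smooth_atI[OF o c(2) smooth_ricci[OF o e e]]])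
    also have "frechet_derivative (\<lambda>y. ricci A D (?e i) (?e j) (chart_inv c y)) (at ?x)
        = frechet_derivative (?S i j) (at ?x)"
      by (rule frechet_derivative_cong_open(1)[OF V]) (rule S_ricci[symmetric])
    finally show ?thesis unfolding dS_def coord_bilinear_axis ..
  qed
  ultimately show ?thesis unfolding metric_defect_def by simp
qed

text \<open>With \<open>r\<close> for the Ricci coefficients, the numerator is \<epsilon> times the
  determinant of \<open>r\<close> and the denominator is \<epsilon> squared times it. Definiteness
  is used to see that the determinant is not zero.\<close>

lemma gauss_curvature_ricci_metric:
  assumes lc: "levi_civita A (ricci_metric \<epsilon>) D"
  shows "gauss_curvature A (ricci_metric \<epsilon>) p = 1 / \<epsilon>"
proof -
  define D' where "D' = (SOME D. levi_civita A (ricci_metric \<epsilon>) D)"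
  have lc': "levi_civita A (ricci_metric \<epsilon>) D'" unfolding D'_def by (rule someI[where P = "levi_civita A (ricci_metric \<epsilon>)", OF lc])
  define c where "c = chart_at A p"
  have c: "c \<in> A" "p \<in> chart_dom c" using chart_at unfolding c_def by auto
  define e where "e = coord_field A c"
  define r where "r i j = ricci A D (e i) (e j) p" for i j
  define R where "R = curvature A D (e 1) (e 2) (e 2)"
  note o = open_dom[OF c(1)]
  have e: "smooth_field A (chart_dom c) (e i)" for i
    unfolding e_def by (rule smooth_field_coord[OF c(1) order_refl])
  have R: "smooth_field A (chart_dom c) R"
    unfolding R_def by (rule smooth_curvature[OF o e e e])
  have zero: "components c (curvature A D (e i) (e i) X p) = 0" if "smooth_field A (chart_dom c) X" for i X
  proof -
    have "components c (curvature A D (e i) (e i) X p) = - components c (curvature A D (e i) (e i) X p)"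
      using arg_cong[OF curvature_antisym[OF o e e that c(2), of i i], of "components c"] by simp
    then show ?thesis by (simp add: eq_neg_iff_add_eq_0 vec_eq_iff)
  qed
  have "components c (curvature A D (e 2) (e 1) (e 2) p) = - components c (R p)"
    using arg_cong[OF curvature_antisym[OF o e e e c(2), of 1 2 2], of "components c"] by (simp add: R_def)
  \<comment> \<open>Each trace has two terms, and one of them contains
    \<open>R(e i, e i) = 0\<close>; the other is, up to sign, a single component of
    \<open>R\<close>.\<close>
  then have Rc: "components c (R p) $ 1 = r 2 2" "components c (R p) $ 2 = - r 1 2"
    using ricci_chart[OF o c(2) e e c, of 2 2] ricci_chart[OF o c(2) e e c, of 1 2] zero[OF e]
    by (simp_all add: r_def sum_2 e_def[symmetric] R_def)
  have r_sym: "r 2 1 = r 1 2"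
    unfolding r_def by (rule ricci_symmetric[OF o c(2) e e])
  have "ricci A D R (e 1) p = r 2 2 * r 1 1 - r 1 2 * r 1 2"
    using ricci_expand[OF o c(2) R e c, of 1] c r_sym
    by (simp add: sum_2 e_def[symmetric] r_def[symmetric] Rc) (simp add: e_def axis_def)
  then have num: "ricci_metric \<epsilon> p (curvature A D' (e 1) (e 2) (e 2) p) (e 1 p) = \<epsilon> * (r 1 1 * r 2 2 - (r 1 2)\<^sup>2)"
    using ricci_metric_field[OF o c(2) R e, of \<epsilon> 1]
      levi_civita_curvature_unique[OF riemannian_ricci_metric lc lc' o c(2) e e e, of 1 2 2]
    by (simp add: R_def power2_eq_square mult.commute)
  have m: "ricci_metric \<epsilon> p (e i p) (e j p) = \<epsilon> * r i j" for i j
    unfolding r_def by (rule ricci_metric_field[OF o c(2) e e])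
  have pos: "\<epsilon> * (w $ 1 * w $ 1 * r 1 1 + 2 * (w $ 1 * w $ 2 * r 1 2) + w $ 2 * w $ 2 * r 2 2) > 0"
    if "w \<noteq> 0" for w :: "real^2"
  proof -
    let ?X = "\<lambda>q. coord_vec A c q w"
    note X = smooth_field_const[OF c(1), of w]
    have "?X p \<noteq> 0" using \<open>w \<noteq> 0\<close> components_coord_vec[OF c, of w] components_zero by metis
    from ricci_definite[OF o c(2) X this] show ?thesis
      using ricci_expand[OF o c(2) X X c] c r_sym
      by (simp add: sum_2 e_def[symmetric] r_def[symmetric] algebra_simps)
  qed
  have r2: "\<epsilon> * r 2 2 > 0" using pos[of "axis 2 1"] axis_eq_0_iff[of 2 "1::real"] by (simp add: axis_def)
  \<comment> \<open>The value of the quadratic form \<open>r\<close> at this vector is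
    \<open>r 2 2\<close> times the determinant; its entries are also the components of
    \<open>R\<close> at \<open>p\<close>.\<close>
  define w :: "real^2" where "w = (\<chi> i. if i = 1 then r 2 2 else - r 1 2)"
  have w: "w $ 1 = r 2 2" "w $ 2 = - r 1 2" by (simp_all add: w_def)
  have "w \<noteq> 0" using r2 w(1) by auto
  from pos[OF this] have "\<epsilon> * r 2 2 * (r 1 1 * r 2 2 - (r 1 2)\<^sup>2) > 0"
    unfolding w by (simp add: power2_eq_square algebra_simps)
  then have "r 1 1 * r 2 2 - (r 1 2)\<^sup>2 \<noteq> 0" "\<epsilon> \<noteq> 0" using r2 by auto
  moreover have "gauss_curvature A (ricci_metric \<epsilon>) p
      = \<epsilon> * (r 1 1 * r 2 2 - (r 1 2)\<^sup>2) / (\<epsilon> * r 1 1 * (\<epsilon> * r 2 2) - (\<epsilon> * r 1 2)\<^sup>2)"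
    unfolding gauss_curvature_def Let_def c_def[symmetric] D'_def[symmetric] e_def[symmetric] num m ..
  moreover have "\<epsilon> * r 1 1 * (\<epsilon> * r 2 2) - (\<epsilon> * r 1 2)\<^sup>2 = \<epsilon> * (\<epsilon> * (r 1 1 * r 2 2 - (r 1 2)\<^sup>2))"
    by (simp add: power2_eq_square algebra_simps)
  ultimately show ?thesis by simp
qed

end

lemma totally_geodesic_levi_civita:
  fixes A :: "'a::{t2_space, second_countable_topology} chart set"
  assumes "surface A" "is_connection A D" "torsion_free A D" and lag: "lagrangian A D"
    and tg: "totally_geodesic A D"
    and def: "\<And>W X p. open W \<Longrightarrow> smooth_field A W X \<Longrightarrow> p \<in> W \<Longrightarrow> X p \<noteq> 0 \<Longrightarrow> \<epsilon> * ricci_sym A D X X p > 0"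
  shows "\<exists>g. riemannian_metric A g \<and> levi_civita A g D \<and> (\<forall>p. gauss_curvature A g p = 1 / \<epsilon>)"
proof -
  interpret definite_ricci A D \<epsilon>
  proof (unfold_locales)
    fix W p X Y assume "open W" "p \<in> W" "smooth_field A W X" "smooth_field A W Y"
    then have "ricci_skew A D X Y p = 0" using lag unfolding lagrangian_def by blast
    then show "ricci A D X Y p = ricci A D Y X p" by (simp add: ricci_skew_def)
  next
    fix W p X assume "open W" "p \<in> W" "smooth_field A W X" "X p \<noteq> 0"
    then show "\<epsilon> * ricci A D X X p > 0" using def[of W X p] by (simp add: ricci_sym_def)
  qed (use assms in auto)
  have lc: "levi_civita A (ricci_metric \<epsilon>) D"
    by (rule levi_civita_ricci_metric) (rule metric_defect_coord[OF tg])
  then show ?thesis using riemannian_ricci_metric gauss_curvature_ricci_metric by blast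
qed

theorem proposition5p4:
  fixes A :: "'a::{t2_space, second_countable_topology} chart set"
    and D :: "'a covd"
  assumes "oriented_surface A"
    and "is_connection A D" and "torsion_free A D"
    and "lagrangian A D"
    and "timelike A D \<or> spacelike A D"
    and "totally_geodesic A D"
  shows "(timelike A D \<longrightarrow>
           (\<exists>g. riemannian_metric A g \<and> levi_civita A g D \<and> (\<forall>p. gauss_curvature A g p = 1))) \<and>
         (spacelike A D \<longrightarrow>
           (\<exists>g. riemannian_metric A g \<and> levi_civita A g D \<and> (\<forall>p. gauss_curvature A g p = -1)))"
proof (intro conjI impI)
  have s: "surface A" using assms(1) by (simp add: oriented_surface_def)
  \<comment> \<open>The two causal types are the instances \<epsilon> = 1 and \<epsilon> = -1, for
    which 1/\<epsilon> is the asserted curvature.\<close>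
  note tg = totally_geodesic_levi_civita[OF s assms(2,3,4,6)]
  show "\<exists>g. riemannian_metric A g \<and> levi_civita A g D \<and> (\<forall>p. gauss_curvature A g p = 1)" if "timelike A D"
    using tg[of 1] that unfolding timelike_def by auto
  show "\<exists>g. riemannian_metric A g \<and> levi_civita A g D \<and> (\<forall>p. gauss_curvature A g p = -1)" if "spacelike A D"
    using tg[of "-1"] that unfolding spacelike_def by auto
qed

end
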